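(* Let $k\ge2$ be an integer, $\lambda\ge0$, $p\in\{0,1,\dots,k-1\}$, and let $y_{p,k}=(\cos\frac{p\pi}{k},\sin\frac{p\pi}{k})$. Then for all $x=(x_1,x_2)\in\mathbb{R}^2$ with $\|x\|=1$ and all $0\le r<1$, $$P(h_\lambda;x,r\,y_{p,k})=\sum_{n=0}^\infty\left(\frac{Y_{n,1}(x)Y_{n,1}(y_{p,k})}{H_{n,1}}+\frac{Y_{n,2}(x)Y_{n,2}(y_{p,k})}{H_{n,2}}\right)r^n$$ $$=\frac{1-r^2}{\left(1-2r\left(\cos\left(\frac{p\pi}{k}\right)x_1+\sin\left(\frac{p\pi}{k}\right)x_2\right)+r^2\right)\left(1-2(-1)^pr^kT_k(x_1)+r^{2k}\right)^{\lambda}}.$$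
   Context: $T_k$ is the Chebyshev polynomial of the first kind, $T_k(\cos\theta)=\cos k\theta$. Dihedral group $I_k$: positive roots $v_j=(\sin\frac{j\pi}{k},-\cos\frac{j\pi}{k})$, $0\le j\le k-1$, with reflections $x\sigma_j=x-2\langle x,v_j\rangle v_j$. The Dunkl operators with one parameter $\lambda$ are $$D_1g(x)=\frac{\partial g}{\partial x_1}+\lambda\sum_{j=0}^{k-1}\frac{g(x)-g(x\sigma_j)}{\langle x,v_j\rangle}\sin\tfrac{j\pi}{k},\qquad D_2g(x)=\frac{\partial g}{\partial x_2}-\lambda\sum_{j=0}^{k-1}\frac{g(x)-g(x\sigma_j)}{\langle x,v_j\rangle}\cos\tfrac{j\pi}{k}.$$ Let $\Delta_h=D_1^2+D_2^2$. An $h$-harmonic of degree $n$ is a homogeneous polynomial $Y$ of degree $n$ in $(x_1,x_2)$ with $\Delta_hY=0$; the space of these is $\mathcal{H}_n(h_\lambda)$, of dimension $1$ for $n=0$ and $2$ for $n\ge1$. The weight $h_\lambda$ on the unit circle is $h_\lambda(\cos\theta,\sin\theta)=|\sin k\theta|^\lambda$, and the inner product is $\langle Y,Z\rangle=c_\lambda\int_0^{2\pi}Y(\cos\theta,\sin\theta)Z(\cos\theta,\sin\theta)|\sin k\theta|^{2\lambda}\,d\theta$, with $c_\lambda$ such that $\langle1,1\rangle=1$. For each $n\ge1$, $\{Y_{n,1},Y_{n,2}\}$ is an orthogonal basis of $\mathcal{H}_n(h_\lambda)$ for this inner product and $H_{n,i}=\langle Y_{n,i},Y_{n,i}\rangle$;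 for $n=0$ only the term with $Y_{0,1}=1$, $H_{0,1}=1$ is present. The reproducing kernel of $\mathcal{H}_n(h_\lambda)$ is $P_n(h_\lambda;x,y)=\sum_iY_{n,i}(x)Y_{n,i}(y)/H_{n,i}$ (independent of the choice of orthogonal basis), and the Poisson kernel is $P(h_\lambda;x,ry)=\sum_{n\ge0}P_n(h_\lambda;x,y)r^n$ for $\|x\|=\|y\|=1$, $0\le r<1$. *)

theory Defs
  imports "HOL-Analysis.Analysis" "HOL-Computational_Algebra.Polynomial"
begin

fun chebyshev_T :: "nat \<Rightarrow> real poly" where
  "chebyshev_T 0 = 1"
| "chebyshev_T (Suc 0) = [:0, 1:]"
| "chebyshev_T (Suc (Suc n)) = [:0, 2:] * chebyshev_T (Suc n) - chebyshev_T n"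

lemma poly_chebyshev_T_cos: "poly (chebyshev_T n) (cos t) = cos (real n * t)"
proof (induction n rule: chebyshev_T.induct)
  case (3 n)
  have "cos (real (Suc (Suc n)) * t) + cos (real n * t) = 2 * cos t * cos (real (Suc n) * t)"
    using cos_times_cos[of "real (Suc n) * t" t] by (simp add: algebra_simps)
  with 3 show ?case by simp
qed simp_all

definition circle_point :: "real \<Rightarrow> real ^ 2" where
  "circle_point t = vector [cos t, sin t]"

definition dihedral_root :: "nat \<Rightarrow> nat \<Rightarrow> real ^ 2" where
  "dihedral_root k j = vector [sin (real j * pi / real k), - cos (real j * pi / real k)]"

text \<open>The reflection in the line orthogonal to a unit vector \<open>v\<close>.\<close>

definition reflect :: "real ^ 2 \<Rightarrow> real ^ 2 \<Rightarrow> real ^ 2" where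
  "reflect v x = x - (2 * (x \<bullet> v)) *\<^sub>R v"

text \<open>
  The difference quotient \<open>(g x - g (reflect v x)) / (x \<bullet> v)\<close> of a polynomial \<open>g\<close> is
  again a polynomial, and Dunkl operators are understood with this quotient also on the
  line \<open>x \<bullet> v = 0\<close>. The limit produces its value there (where Isabelle's division
  would give 0); off that line, it agrees with the plain quotient whenever \<open>g\<close> is continuous.
\<close>

definition reflection_quotient :: "real ^ 2 \<Rightarrow> (real ^ 2 \<Rightarrow> real) \<Rightarrow> real ^ 2 \<Rightarrow> real" where
  "reflection_quotient v g x =
     Lim (at x within {z. z \<bullet> v \<noteq> 0}) (\<lambda>z. (g z - g (reflect v z)) / (z \<bullet> v))"

text \<open>
  \<open>dunkl k l i\<close> is the Dunkl operator \<open>D\<^sub>i\<close>; the coordinates of the root are the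
  factors \<open>sin (j\<pi>/k)\<close> for \<open>i = 1\<close> and \<open>- cos (j\<pi>/k)\<close> for \<open>i = 2\<close>.
\<close>

definition dunkl :: "nat \<Rightarrow> real \<Rightarrow> 2 \<Rightarrow> (real ^ 2 \<Rightarrow> real) \<Rightarrow> real ^ 2 \<Rightarrow> real" where
  "dunkl k l i g x =
     frechet_derivative g (at x) (axis i 1) +
     l * (\<Sum>j<k. reflection_quotient (dihedral_root k j) g x * dihedral_root k j $ i)"

definition h_laplacian :: "nat \<Rightarrow> real \<Rightarrow> (real ^ 2 \<Rightarrow> real) \<Rightarrow> real ^ 2 \<Rightarrow> real" where
  "h_laplacian k l g x = dunkl k l 1 (dunkl k l 1 g) x + dunkl k l 2 (dunkl k l 2 g) x"

definition homogeneous_polynomial :: "nat \<Rightarrow> (real ^ 2 \<Rightarrow> real) \<Rightarrow> bool" where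
  "homogeneous_polynomial n g \<longleftrightarrow>
     (\<exists>a. \<forall>x. g x = (\<Sum>j\<le>n. a j * (x $ 1) ^ j * (x $ 2) ^ (n - j)))"

definition h_harmonics :: "nat \<Rightarrow> real \<Rightarrow> nat \<Rightarrow> (real ^ 2 \<Rightarrow> real) set" where
  "h_harmonics k l n = {g. homogeneous_polynomial n g \<and> (\<forall>x. h_laplacian k l g x = 0)}"

text \<open>
  The squared weight. For \<open>l = 0\<close> the convention \<open>0 powr 0 = 0\<close> gives the value 0
  instead of 1 at the finitely many zeros of \<open>sin (k t)\<close> in a period, which does not
  affect the integrals below.
\<close>

definition weight_sq :: "nat \<Rightarrow> real \<Rightarrow> real \<Rightarrow> real" where
  "weight_sq k l t = \<bar>sin (real k * t)\<bar> powr (2 * l)"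

definition weight_const :: "nat \<Rightarrow> real \<Rightarrow> real" where
  "weight_const k l = 1 / integral {0..2 * pi} (weight_sq k l)"

definition h_inner :: "nat \<Rightarrow> real \<Rightarrow> (real ^ 2 \<Rightarrow> real) \<Rightarrow> (real ^ 2 \<Rightarrow> real) \<Rightarrow> real" where
  "h_inner k l g f = weight_const k l *
     integral {0..2 * pi} (\<lambda>t. g (circle_point t) * f (circle_point t) * weight_sq k l t)"

definition basis_index :: "nat \<Rightarrow> nat set" where
  "basis_index n = (if n = 0 then {1} else {1, 2})"

text \<open>
  \<open>B\<close> restricted to \<open>basis_index n\<close> is an orthogonal basis of the space of h-harmonics of
  degree \<open>n\<close>: membership, spanning, linear independence, orthogonality.
\<close>

definition orthogonal_basis :: "nat \<Rightarrow> real \<Rightarrow> nat \<Rightarrow> (nat \<Rightarrow> real ^ 2 \<Rightarrow> real) \<Rightarrow> bool" where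
  "orthogonal_basis k l n B \<longleftrightarrow>
     (\<forall>i\<in>basis_index n. B i \<in> h_harmonics k l n) \<and>
     (\<forall>g\<in>h_harmonics k l n. \<exists>c. \<forall>x. g x = (\<Sum>i\<in>basis_index n. c i * B i x)) \<and>
     (\<forall>c. (\<forall>x. (\<Sum>i\<in>basis_index n. c i * B i x) = 0) \<longrightarrow> (\<forall>i\<in>basis_index n. c i = 0)) \<and>
     (\<forall>i\<in>basis_index n. \<forall>j\<in>basis_index n. i \<noteq> j \<longrightarrow> h_inner k l (B i) (B j) = 0)"

definition kernel_sum ::
    "nat \<Rightarrow> real \<Rightarrow> nat \<Rightarrow> (nat \<Rightarrow> real ^ 2 \<Rightarrow> real) \<Rightarrow> real ^ 2 \<Rightarrow> real ^ 2 \<Rightarrow> real" where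
  "kernel_sum k l n B x y = (\<Sum>i\<in>basis_index n. B i x * B i y / h_inner k l (B i) (B i))"

text \<open>
  The reproducing kernel does not depend on the orthogonal basis, so that an arbitrary one is
  chosen here.
\<close>

definition reproducing_kernel :: "nat \<Rightarrow> real \<Rightarrow> nat \<Rightarrow> real ^ 2 \<Rightarrow> real ^ 2 \<Rightarrow> real" where
  "reproducing_kernel k l n = kernel_sum k l n (SOME B. orthogonal_basis k l n B)"

text \<open>\<open>poisson_kernel k l x r y\<close> is \<open>P(h; x, r y)\<close>, for \<open>x\<close> and \<open>y\<close> on the unit circle.\<close>

definition poisson_kernel :: "nat \<Rightarrow> real \<Rightarrow> real ^ 2 \<Rightarrow> real \<Rightarrow> real ^ 2 \<Rightarrow> real" where
  "poisson_kernel k l x r y = (\<Sum>n. reproducing_kernel k l n x y * r ^ n)"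

end

theory Submission
  imports Defs
begin

text \<open>
  Write \<open>z\<close> for the complex number of \<open>x\<close> and \<open>W = |1 - r^k z^k| powr (- 2 l)\<close>. The function \<open>W / (1 - r z)\<close>
  of \<open>z\<close> is annihilated by the complex Dunkl operator \<open>D\<^sub>1 + i D\<^sub>2\<close>, because \<open>W\<close> is invariant under the
  dihedral group and the difference quotients of \<open>1 / (1 - r z)\<close> cancel against the derivative of \<open>W\<close>.
  Hence the coefficients \<open>\<phi>\<^sub>n\<close> of its expansion in powers of \<open>r\<close> are homogeneous polynomials with
  \<open>D\<^sub>1 \<phi>\<^sub>n = c\<^sub>n \<phi>\<^sub>n\<^sub>-\<^sub>1\<close> and \<open>D\<^sub>2 \<phi>\<^sub>n = i c\<^sub>n \<phi>\<^sub>n\<^sub>-\<^sub>1\<close>, and the functions \<open>Re (d \<phi>\<^sub>n)\<close> with \<open>d\<close> complex are the h-harmonics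
  of degree \<open>n\<close>. On the unit circle \<open>\<phi>\<^sub>n\<close> is, up to a power of \<open>z\<close>, a polynomial in \<open>z^(2 k)\<close> that is
  orthogonal with respect to the weight \<open>|1 - \<zeta>| powr (2 l)\<close>; this gives all inner products of h-harmonics.
  At \<open>y = (cos (p \<pi> / k), sin (p \<pi> / k))\<close> the coefficients of the claimed closed form have the
  reproducing property, which determines the kernel.
\<close>

text \<open>The arguments with generating functions are carried out as identities between
  coefficients; power series are summed only on the unit circle. Writing
  \<open>1 / (1 - r z)\<close> as \<open>(1 + r z + ... + (r z)^(k - 1)) / (1 - (r z)^k)\<close>
  raises one of the two exponents of W from l to l + 1, which is the origin of the asymmetric
  coefficients below. The case distinctions on \<open>k dvd n\<close> have one cause: the integral
  of \<phi>_n^2 vanishes otherwise, but in general not for \<open>k dvd n\<close>, where real and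
  imaginary part of \<phi>_n then have different norms. The points y are special because
  \<open>u ^ k\<close> is real for the complex number u of y. Rotation by u then multiplies \<phi>_n
  by \<open>u ^ n\<close>, so that the kernel at y is \<phi>_n at \<open>x * cnj u\<close> up to a
  real factor. The closed form is W times the classical Poisson kernel, the real part of
  \<open>2 / (1 - r z) - 1\<close>. A given orthogonal basis consists of functions Re (d \<phi>_n)
  because it spans Re \<phi>_n and Im \<phi>_n, which are independent by positivity of the
  norm.\<close>

section \<open>Orthogonal polynomials on the circle\<close>

text \<open>The coefficients of \<open>(1 - X) powr (- a)\<close>.\<close>

definition negbin :: "real \<Rightarrow> nat \<Rightarrow> real" where
  "negbin a n = pochhammer a n / fact n"

lemma negbin_0 [simp]: "negbin a 0 = 1"
  by (simp add: negbin_def)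

lemma Suc_negbin_Suc: "real (Suc n) * negbin a (Suc n) = (a + real n) * negbin a n"
  by (simp add: negbin_def pochhammer_Suc field_simps del: of_nat_Suc)

lemma Suc_negbin_Suc': "real (Suc n) * negbin a (Suc n) = a * negbin (a + 1) n"
  by (simp add: negbin_def pochhammer_rec field_simps del: of_nat_Suc)

lemma mult_negbin_plus1: "a * negbin (a + 1) n = (a + real n) * negbin a n"
  using Suc_negbin_Suc[of n a] Suc_negbin_Suc'[of n a] by simp

text \<open>Compare coefficients in
  \<open>(1 - X) powr (- a) = (1 - X) * (1 - X) powr (- a - 1)\<close>.\<close>

lemma negbin_plus1_Suc: "negbin (a + 1) (Suc n) = negbin (a + 1) n + negbin a (Suc n)"
proof -
  have "real (Suc n) * negbin (a + 1) (Suc n) = real (Suc n) * (negbin (a + 1) n + negbin a (Suc n))"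
    unfolding distrib_left Suc_negbin_Suc[of n "a + 1"] Suc_negbin_Suc'[of n a]
    by (simp add: algebra_simps)
  then show ?thesis
    by (metis mult_cancel_left nat.simps(3) of_nat_eq_0_iff)
qed

text \<open>Partial sums arise from multiplication by \<open>1 / (1 - X)\<close>.\<close>

lemma sum_negbin: "(\<Sum>i\<le>n. negbin a i) = negbin (a + 1) n"
  by (induction n) (simp_all add: negbin_plus1_Suc)

lemma negbin_pos: "a > 0 \<Longrightarrow> negbin a n > 0"
  by (simp add: negbin_def pochhammer_pos)

lemma negbin_nonneg: "a \<ge> 0 \<Longrightarrow> negbin a n \<ge> 0"
  by (cases "a = 0") (simp_all add: negbin_def pochhammer_nonneg pochhammer_0_left)

text \<open>The Chu-Vandermonde convolution: powers of \<open>1 - X\<close> multiply by adding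
  exponents.\<close>

lemma sum_negbin_mult: "(\<Sum>i\<le>n. negbin a i * negbin b (n - i)) = negbin (a + b) n"
proof -
  have "negbin (a + b) n = (\<Sum>i\<le>n. real (n choose i) * pochhammer a i * pochhammer b (n - i) / fact n)"
    by (simp add: negbin_def pochhammer_binomial_sum sum_divide_distrib)
  also have "\<dots> = (\<Sum>i\<le>n. negbin a i * negbin b (n - i))"
    by (intro sum.cong) (simp_all add: negbin_def binomial_fact)
  finally show ?thesis by simp
qed

text \<open>
  \<open>szego_coeff l q b\<close> is the coefficient of \<open>\<zeta> ^ (q - b)\<close> in the polynomial of degree \<open>q\<close> orthogonal with respect
  to the weight \<open>|1 - \<zeta>| powr (2 l)\<close> on the unit circle; these polynomials have the generating function
  \<open>(1 - s) powr (- l) (1 - s \<zeta>) powr (- l - 1)\<close>.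
\<close>

definition szego_coeff :: "real \<Rightarrow> nat \<Rightarrow> nat \<Rightarrow> real" where
  "szego_coeff l q b = negbin l b * negbin (l + 1) (q - b)"

text \<open>Multiplying the generating function by \<open>1 - s \<zeta>\<close> leaves the symmetric
  product with both exponents \<open>- l\<close>. The values \<open>g b\<close> are vectors because
  the identity serves both real moments and complex monomials.\<close>

lemma szego_coeff_sum_Suc:
  fixes g :: "nat \<Rightarrow> 'a::real_vector"
  shows "(\<Sum>b\<le>Suc q. szego_coeff l (Suc q) b *\<^sub>R g b) =
    (\<Sum>b\<le>Suc q. (negbin l b * negbin l (Suc q - b)) *\<^sub>R g b) + (\<Sum>b\<le>q. szego_coeff l q b *\<^sub>R g b)"
proof -
  have "(\<Sum>b\<le>q. szego_coeff l (Suc q) b *\<^sub>R g b) =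
     (\<Sum>b\<le>q. (negbin l b * negbin l (Suc q - b)) *\<^sub>R g b + szego_coeff l q b *\<^sub>R g b)"
    by (intro sum.cong)
      (auto simp: szego_coeff_def Suc_diff_le negbin_plus1_Suc distrib_left scaleR_add_left)
  then show ?thesis
    by (simp add: sum.distrib szego_coeff_def)
qed

text \<open>Read \<open>f m\<close> as the value of a linear functional at \<zeta>^m. With \<Phi>_q
  the polynomial of degree q and R_q its reversal, this is \<Phi>_(q+1) - \<zeta> \<Phi>_q = R_(q+1)
  - R_q. Both sides equal the symmetric sum of \<open>szego_coeff_sum_Suc\<close>, which is
  invariant under reversal.\<close>

lemma szego_recurrence_difference:
  fixes f :: "nat \<Rightarrow> real"
  shows "(\<Sum>b\<le>Suc q. szego_coeff l (Suc q) b * f (Suc q - b)) - (\<Sum>b\<le>q. szego_coeff l q b * f (Suc q - b)) =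
    (\<Sum>b\<le>Suc q. szego_coeff l (Suc q) b * f b) - (\<Sum>b\<le>q. szego_coeff l q b * f b)"
proof -
  have "(\<Sum>b\<le>Suc q. negbin l b * negbin l (Suc q - b) * f b) =
      (\<Sum>b\<le>Suc q. negbin l (Suc q - b) * negbin l (Suc q - (Suc q - b)) * f (Suc q - b))"
    by (rule sum.nat_diff_reindex[symmetric, of "\<lambda>b. negbin l b * negbin l (Suc q - b) * f b" "Suc (Suc q)", 
         unfolded lessThan_Suc_atMost diff_Suc_Suc])
  also have "\<dots> = (\<Sum>b\<le>Suc q. negbin l b * negbin l (Suc q - b) * f (Suc q - b))"
    by (intro sum.cong) auto
  finally show ?thesis
    using szego_coeff_sum_Suc[of l q f] szego_coeff_sum_Suc[of l q "\<lambda>b. f (Suc q - b)"] by simp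
qed

text \<open>The Szego recurrence (q + 1) \<Phi>_(q+1) = (l + q + 1) \<zeta> \<Phi>_q + l R_q, again
  under a linear functional f.\<close>

lemma szego_recurrence:
  fixes f :: "nat \<Rightarrow> real"
  shows "real (Suc q) * (\<Sum>b\<le>Suc q. szego_coeff l (Suc q) b * f (Suc q - b)) =
    (l + real (Suc q)) * (\<Sum>b\<le>q. szego_coeff l q b * f (Suc q - b)) + l * (\<Sum>b\<le>q. szego_coeff l q b * f b)"
proof -
  \<comment> \<open>\<open>s\<close> and \<open>t\<close> are the coefficients of \<zeta> \<Phi>_q
    and R_q, extended by 0 so that all sums run up to \<open>Suc q\<close>. The claim for one
    coefficient is split along \<open>Suc q = b + m\<close>: the part with factor b yields
    \<open>t\<close>, the part with factor m yields the additional l.\<close>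
  define s where "s b = (if b \<le> q then szego_coeff l q b else 0)" for b
  define t where "t b = (if b = 0 then 0 else szego_coeff l q (Suc q - b))" for b
  have coeff: "real (Suc q) * szego_coeff l (Suc q) b = (l + real (Suc q)) * s b + l * t b"
    if "b \<le> Suc q" for b
  proof -
    define m where "m = Suc q - b"
    have q: "real (Suc q) = real b + real m"
      using that by (simp add: m_def)
    have "real b * szego_coeff l (Suc q) b = l * t b + real b * s b"
    proof (cases b)
      case (Suc b')
      have 1: "real b * negbin l b = l * negbin (l + 1) b'"
        unfolding Suc by (rule Suc_negbin_Suc')
      show ?thesis
      proof (cases m)
        case 0
        then have "b = Suc q" using that by (simp add: m_def)
        then show ?thesis using 1 Suc by (simp add: szego_coeff_def s_def t_def algebra_simps)
      next
        case (Suc m')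
        then have b: "q - b = m'" "Suc q - b = Suc m'" "b \<le> q"
          using \<open>b = Suc b'\<close> by (auto simp: m_def)
        then have "b' = q - Suc m'" using \<open>b = Suc b'\<close> by auto
        with b have "szego_coeff l (Suc q) b = negbin l b * (negbin (l + 1) m' + negbin l (Suc m'))"
          and "t b = negbin l (Suc m') * negbin (l + 1) b'" and "s b = negbin l b * negbin (l + 1) m'"
          using \<open>b = Suc b'\<close> by (simp_all add: szego_coeff_def s_def t_def negbin_plus1_Suc)
        with 1 show ?thesis by algebra
      qed
    qed (simp add: t_def)
    moreover have "real m * szego_coeff l (Suc q) b = (l + real m) * s b"
    proof (cases m)
      case 0
      then show ?thesis using that by (simp add: s_def m_def)
    next
      case (Suc m')
      then have "q - b = m'" "Suc q - b = Suc m'" "b \<le> q" by (auto simp: m_def)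
      moreover have "real m * negbin (l + 1) m = (l + real m) * negbin (l + 1) m'"
        using Suc_negbin_Suc[of m' "l + 1"] Suc by simp
      ultimately show ?thesis
        by (simp add: szego_coeff_def s_def Suc)
    qed
    ultimately show ?thesis unfolding q by (simp add: algebra_simps)
  qed
  have "real (Suc q) * (\<Sum>b\<le>Suc q. szego_coeff l (Suc q) b * f (Suc q - b)) =
      (\<Sum>b\<le>Suc q. ((l + real (Suc q)) * s b + l * t b) * f (Suc q - b))"
    unfolding sum_distrib_left
    by (intro sum.cong refl) (simp only: atMost_iff coeff mult.assoc[symmetric])
  also have "\<dots> = (l + real (Suc q)) * (\<Sum>b\<le>Suc q. s b * f (Suc q - b)) +
      l * (\<Sum>b\<le>Suc q. t b * f (Suc q - b))"
    by (simp only: distrib_right sum.distrib sum_distrib_left mult.assoc)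
  also have "(\<Sum>b\<le>Suc q. s b * f (Suc q - b)) = (\<Sum>b\<le>q. szego_coeff l q b * f (Suc q - b))"
    by (simp add: s_def)
  also have "(\<Sum>b\<le>Suc q. t b * f (Suc q - b)) = (\<Sum>b\<le>q. szego_coeff l q (q - b) * f (q - b))"
    by (subst sum.atMost_Suc_shift) (simp add: t_def)
  also have "\<dots> = (\<Sum>b\<le>q. szego_coeff l q b * f b)"
    using sum.nat_diff_reindex[of "\<lambda>b. szego_coeff l q b * f b" "Suc q"] by (simp add: lessThan_Suc_atMost)
  finally show ?thesis .
qed

text \<open>The integral of \<open>\<zeta> ^ m\<close> for that weight, normalized to total mass 1.\<close>

definition moment :: "real \<Rightarrow> int \<Rightarrow> real" where
  "moment l m = negbin (- l) (nat \<bar>m\<bar>) / negbin (l + 1) (nat \<bar>m\<bar>)"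

lemma moment_minus [simp]: "moment l (- m) = moment l m"
  by (simp add: moment_def)

lemma moment_0 [simp]: "moment l 0 = 1"
  by (simp add: moment_def)

lemma moment_of_nat: "moment l (int n) = negbin (- l) n / negbin (l + 1) n"
  by (simp add: moment_def)

text \<open>The same recurrence is derived for the actual integrals in
  \<open>weight_fourier_recurrence\<close>. It is kept free of quotients of moments because moments
  vanish from some index on when l is a natural number.\<close>

lemma moment_Suc:
  assumes "l \<ge> 0"
  shows "(real m + 1 + l) * moment l (int (Suc m)) = (real m - l) * moment l (int m)"
proof -
  have p: "negbin (l + 1) m > 0" "negbin (l + 1) (Suc m) > 0"
    using assms by (auto intro!: negbin_pos)
  have n: "nat (1 + int m) = Suc m" by simp
  have e: "real (Suc m) * negbin (l + 1) (Suc m) = (real m + 1 + l) * negbin (l + 1) m"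
    using Suc_negbin_Suc[of m "l + 1"] by (simp add: algebra_simps)
  have e': "real (Suc m) * negbin (- l) (Suc m) = (real m - l) * negbin (- l) m"
    using Suc_negbin_Suc[of m "- l"] by (simp add: algebra_simps)
  have "(real m + 1 + l) * negbin (l + 1) m * negbin (- l) (Suc m) =
        (real m - l) * negbin (- l) m * negbin (l + 1) (Suc m)"
    unfolding e[symmetric] e'[symmetric] by simp
  with p show ?thesis
    by (simp add: moment_def n field_simps)
qed

text \<open>The inner product of \<Phi>_q with \<zeta>^j under the normalized weight.\<close>

definition szego_moment :: "real \<Rightarrow> nat \<Rightarrow> int \<Rightarrow> real" where
  "szego_moment l q j = (\<Sum>b\<le>q. szego_coeff l q b * moment l (int (q - b) - j))"

text \<open>The denominators of the moments cancel the factors \<open>negbin (l + 1)\<close> of the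
  coefficients. What remains is the convolution of \<open>(1 - s) powr (- l)\<close> and
  \<open>(1 - s) powr l\<close>, whose product is 1.\<close>

lemma szego_moment_0:
  assumes "l \<ge> 0"
  shows "szego_moment l q 0 = (if q = 0 then 1 else 0)"
proof -
  have "negbin (l + 1) m \<noteq> 0" for m
    using negbin_pos[of "l + 1" m] assms by simp
  then have "szego_moment l q 0 = (\<Sum>b\<le>q. negbin l b * negbin (- l) (q - b))"
    unfolding szego_moment_def by (intro sum.cong) (simp_all add: szego_coeff_def moment_of_nat del: of_nat_diff)
  also have "\<dots> = negbin 0 q"
    by (simp add: sum_negbin_mult)
  finally show ?thesis
    by (cases q) (auto simp: negbin_def pochhammer_rec)
qed

lemma szego_moment_shift:
  "(\<Sum>b\<le>q. szego_coeff l q b * moment l (int (Suc q - b) - j)) = szego_moment l q (j - 1)"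
proof -
  have "moment l (int (Suc q - b) - j) = moment l (int (q - b) - (j - 1))" if "b \<le> q" for b
    using that by (simp add: Suc_diff_le algebra_simps)
  then show ?thesis
    unfolding szego_moment_def by (intro sum.cong) simp_all
qed

text \<open>Since the moments are even in the index, pairing R_q with \<zeta>^j amounts to pairing
  \<Phi>_q with \<zeta>^(q-j).\<close>

lemma szego_moment_flip:
  "(\<Sum>b\<le>q. szego_coeff l q b * moment l (int b - j)) = szego_moment l q (int q - j)"
proof -
  have "moment l (int b - j) = moment l (int (q - b) - (int q - j))" if "b \<le> q" for b
    using that moment_minus[of l "int b - j"] by (simp del: moment_minus)
  then show ?thesis
    unfolding szego_moment_def by (intro sum.cong) simp_all
qed

lemma szego_moment_Suc:
  "real (Suc q) * szego_moment l (Suc q) j =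
     (l + real (Suc q)) * szego_moment l q (j - 1) + l * szego_moment l q (int q - j)"
  using szego_recurrence[of q l "\<lambda>m. moment l (int m - j)"]
  by (simp only: szego_moment_flip szego_moment_shift flip: szego_moment_def)

lemma szego_moment_Suc_top:
  "szego_moment l (Suc q) j - szego_moment l q (j - 1) =
     szego_moment l (Suc q) (int (Suc q) - j) - szego_moment l q (int q - j)"
  using szego_recurrence_difference[of l q "\<lambda>m. moment l (int m - j)"]
  by (simp only: szego_moment_flip szego_moment_shift flip: szego_moment_def)

text \<open>For 1 \<le> j \<le> q the recurrence leads from (q + 1, j) to the indices j - 1 and q -
  j, both in the range where the induction hypothesis applies; j = 0 is
  \<open>szego_moment_0\<close>.\<close>

lemma szego_moment_orthogonal:
  assumes "l \<ge> 0" and "0 \<le> j" and "j < int q"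
  shows "szego_moment l q j = 0"
  using assms(2,3)
proof (induction q arbitrary: j)
  case (Suc q)
  show ?case
  proof (cases "j = 0")
    case True
    then show ?thesis using szego_moment_0[OF \<open>l \<ge> 0\<close>] by simp
  next
    case False
    then have "real (Suc q) * szego_moment l (Suc q) j = 0"
      unfolding szego_moment_Suc using Suc by simp
    then show ?thesis by simp
  qed
qed simp

text \<open>The left side is the squared norm of \<Phi>_q, leading coefficient times pairing with
  \<zeta>^q; the right side is \<Phi>_q(1). Both grow by the ratio (2 l + q + 1) / (q + 1). This
  coincidence later normalizes the kernel at y.\<close>

lemma szego_moment_top:
  assumes "l \<ge> 0"
  shows "szego_moment l q (int q) * negbin (l + 1) q = (\<Sum>b\<le>q. szego_coeff l q b)"
proof (induction q)
  case 0
  then show ?case by (simp add: szego_moment_def szego_coeff_def)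
next
  case (Suc q)
  let ?k = "\<lambda>q. szego_moment l q (int q)" and ?N = "\<lambda>q. \<Sum>b\<le>q. szego_coeff l q b"
  \<comment> \<open>Both recurrences are taken at j = 0, where \<Phi>_(q+1) is orthogonal to 1. They
    share the pairing with index - 1, which lies outside the orthogonality range and is
    eliminated.\<close>
  have "(l + real (Suc q)) * szego_moment l q (- 1) + l * ?k q = 0"
    using szego_moment_Suc[of q l 0] szego_moment_0[OF assms, of "Suc q"] by simp
  moreover have "- szego_moment l q (- 1) = ?k (Suc q) - ?k q"
    using szego_moment_Suc_top[of l q 0] szego_moment_0[OF assms, of "Suc q"] by simp
  ultimately have k: "(l + real (Suc q)) * ?k (Suc q) = (2 * l + real (Suc q)) * ?k q"
    by algebra
  have N: "real (Suc q) * ?N (Suc q) = (2 * l + real (Suc q)) * ?N q"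
    using szego_recurrence[of q l "\<lambda>_. 1"] by (simp add: algebra_simps)
  have S: "real (Suc q) * negbin (l + 1) (Suc q) = (l + real (Suc q)) * negbin (l + 1) q"
    using Suc_negbin_Suc[of q "l + 1"] by (simp add: add.assoc)
  have "real (Suc q) * (?k (Suc q) * negbin (l + 1) (Suc q)) =
      ?k (Suc q) * ((l + real (Suc q)) * negbin (l + 1) q)"
    unfolding S[symmetric] by (simp only: mult_ac)
  also have "\<dots> = ((l + real (Suc q)) * ?k (Suc q)) * negbin (l + 1) q"
    by (simp only: mult_ac)
  also have "\<dots> = real (Suc q) * ?N (Suc q)"
    unfolding k N Suc.IH[symmetric] by (simp only: mult.assoc)
  finally show ?case
    by (metis mult_cancel_left nat.simps(3) of_nat_eq_0_iff)
qed

lemma szego_moment_top_pos: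
  assumes "l \<ge> 0"
  shows "szego_moment l q (int q) > 0"
proof -
  have "(\<Sum>b\<le>q. szego_coeff l q b) \<ge> szego_coeff l q 0"
    using assms by (intro member_le_sum) (auto simp: szego_coeff_def intro!: mult_nonneg_nonneg negbin_nonneg)
  moreover have "szego_coeff l q 0 > 0"
    using assms by (simp add: szego_coeff_def negbin_pos)
  ultimately have "szego_moment l q (int q) * negbin (l + 1) q > 0"
    using szego_moment_top[OF assms] by simp
  then show ?thesis
    using negbin_pos[of "l + 1" q] assms by (simp add: zero_less_mult_iff)
qed

section \<open>The kernel of the complex Dunkl operator\<close>

text \<open>
  The coefficients of \<open>r ^ n\<close> in \<open>W = ((1 - (r z) ^ k) (1 - (r cnj z) ^ k)) powr (- l)\<close> and in \<open>W / (1 - r z)\<close>.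
\<close>

definition weight_poly :: "nat \<Rightarrow> real \<Rightarrow> nat \<Rightarrow> complex \<Rightarrow> complex" where
  "weight_poly k l n z = (if k dvd n then
     (\<Sum>b\<le>n div k. (negbin l b * negbin l (n div k - b)) *\<^sub>R (z ^ (n - k * b) * cnj z ^ (k * b))) else 0)"

definition dunkl_poly :: "nat \<Rightarrow> real \<Rightarrow> nat \<Rightarrow> complex \<Rightarrow> complex" where
  "dunkl_poly k l n z = (\<Sum>b\<le>n div k. szego_coeff l (n div k) b *\<^sub>R (z ^ (n - k * b) * cnj z ^ (k * b)))"

lemma mult_le_of_le_div: "b \<le> n div k \<Longrightarrow> k * b \<le> (n::nat)"
  by (metis le_trans mult_le_mono2 times_div_less_eq_dividend)

lemma dunkl_poly_0 [simp]: "dunkl_poly k l 0 z = 1"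
  by (simp add: dunkl_poly_def szego_coeff_def)

text \<open>This is \<open>(1 - r z) * (W / (1 - r z)) = W\<close> at r^(n+1). The symmetric sum of
  \<open>szego_coeff_sum_Suc\<close> is the coefficient of W and occurs only at multiples of
  k.\<close>

lemma dunkl_poly_Suc:
  assumes "k > 0"
  shows "dunkl_poly k l (Suc n) z = z * dunkl_poly k l n z + weight_poly k l (Suc n) z"
proof -
  let ?q = "n div k"
  have z: "z * dunkl_poly k l n z = (\<Sum>b\<le>?q. szego_coeff l ?q b *\<^sub>R (z ^ (Suc n - k * b) * cnj z ^ (k * b)))"
    unfolding dunkl_poly_def sum_distrib_left
    by (intro sum.cong refl) (simp add: mult_le_of_le_div Suc_diff_le mult.assoc)
  show ?thesis
  proof (cases "k dvd Suc n")
    case True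
    then have "Suc n div k = Suc ?q"
      by (metis div_Suc dvd_imp_mod_0)
    then show ?thesis
      using True by (simp only: z) (simp only: dunkl_poly_def weight_poly_def szego_coeff_sum_Suc if_True add.commute)
  next
    case False
    then have "Suc n div k = ?q"
      by (metis div_Suc dvd_eq_mod_eq_0)
    then show ?thesis
      using False by (simp only: z) (simp add: dunkl_poly_def weight_poly_def)
  qed
qed

text \<open>The dihedral reflections are the maps \<open>z \<mapsto> w * cnj z\<close> with \<open>w ^ k = 1\<close>.\<close>

lemma weight_poly_reflect:
  assumes "w ^ k = 1" and "norm w = 1"
  shows "weight_poly k l n (w * cnj z) = weight_poly k l n z"
proof (cases "k dvd n")
  case True
  then obtain q where n: "n = k * q" by blast
  have cw: "cnj w ^ k = 1" using assms(1) by (metis complex_cnj_one complex_cnj_power)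
  show ?thesis
  proof (cases "k = 0")
    case False
    then have q: "n div k = q" by (simp add: n)
    have pw: "(w * cnj z) ^ (n - k * b) * cnj (w * cnj z) ^ (k * b) = cnj z ^ (k * (q - b)) * z ^ (k * b)" for b
      unfolding n diff_mult_distrib2[symmetric]
      by (simp add: power_mult_distrib power_mult assms(1) cw)
    have "weight_poly k l n (w * cnj z) =
        (\<Sum>b\<le>q. (negbin l b * negbin l (q - b)) *\<^sub>R (cnj z ^ (k * (q - b)) * z ^ (k * b)))"
      using True by (simp only: weight_poly_def q pw if_True)
    \<comment> \<open>The reflection exchanges the k-th powers of \<open>z\<close> and
      \<open>cnj z\<close>; reversing the sum undoes this.\<close>
    also have "\<dots> = (\<Sum>b\<le>q. (negbin l (q - b) * negbin l (q - (q - b))) *\<^sub>R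
        (cnj z ^ (k * (q - (q - b))) * z ^ (k * (q - b))))"
      by (rule sum.nat_diff_reindex[symmetric, of "\<lambda>b. (negbin l b * negbin l (q - b)) *\<^sub>R
        (cnj z ^ (k * (q - b)) * z ^ (k * b))" "Suc q", unfolded lessThan_Suc_atMost diff_Suc_Suc])
    also have "\<dots> = (\<Sum>b\<le>q. (negbin l b * negbin l (q - b)) *\<^sub>R (z ^ (n - k * b) * cnj z ^ (k * b)))"
      unfolding n diff_mult_distrib2[symmetric] by (intro sum.cong) (auto simp: mult_ac)
    also have "\<dots> = weight_poly k l n z"
      using True by (simp only: weight_poly_def q if_True)
    finally show ?thesis .
  qed (simp add: weight_poly_def n)
qed (simp add: weight_poly_def)

text \<open>The coefficient of r^n in \<open>r W / ((1 - r z) (1 - r w cnj z))\<close>, which is the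
  difference of \<open>W / (1 - r z)\<close> and its reflection, divided by
  \<open>z - w * cnj z\<close>. It is a polynomial and thus also defined on the mirror.\<close>

definition dunkl_quotient :: "nat \<Rightarrow> real \<Rightarrow> nat \<Rightarrow> complex \<Rightarrow> complex \<Rightarrow> complex" where
  "dunkl_quotient k l n w z = (\<Sum>i<n. (w * cnj z) ^ i * dunkl_poly k l (n - 1 - i) z)"

lemma dunkl_quotient_Suc:
  "dunkl_quotient k l (Suc n) w z = dunkl_poly k l n z + w * cnj z * dunkl_quotient k l n w z"
  unfolding dunkl_quotient_def
  by (subst sum.lessThan_Suc_shift) (simp add: sum_distrib_left mult_ac)

lemma dunkl_poly_reflect:
  assumes "k > 0" "w ^ k = 1" "norm w = 1"
  shows "dunkl_poly k l n z - dunkl_poly k l n (w * cnj z) = (z - w * cnj z) * dunkl_quotient k l n w z"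
proof (induction n)
  case 0
  then show ?case by (simp add: dunkl_quotient_def)
next
  case (Suc n)
  then have "dunkl_poly k l n (w * cnj z) = dunkl_poly k l n z - (z - w * cnj z) * dunkl_quotient k l n w z"
    by (simp add: algebra_simps)
  note reflect = this
  show ?case
    unfolding dunkl_poly_Suc[OF assms(1)] weight_poly_reflect[OF assms(2,3)] dunkl_quotient_Suc reflect
    by (simp add: algebra_simps)
qed

section \<open>Sums over the k-th roots of unity\<close>

lemma root_of_unity_power:
  assumes "k > 0"
  shows "cis (2 * pi * real j / real k) ^ k = 1"
proof -
  have "real k * (2 * pi * real j / real k) = 2 * pi * real j"
    using assms by simp
  then show ?thesis
    by (simp only: Complex.DeMoivre) simp
qed

lemma sum_roots_of_unity_power:
  assumes "k > 0"
  shows "(\<Sum>j<k. cis (2 * pi * real j / real k) ^ i) = (if k dvd i then of_nat k else 0)"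
proof (cases "k dvd i")
  case True
  then obtain m where i: "i = k * m" by blast
  have "cis (2 * pi * real j / real k) ^ i = 1" for j
    by (simp only: i power_mult root_of_unity_power[OF assms] power_one)
  then show ?thesis using True by simp
next
  case False
  define w where "w = cis (2 * pi * real i / real k)"
  have *: "cis (2 * pi * real j / real k) ^ i = w ^ j" for j
    by (simp add: w_def Complex.DeMoivre mult_ac)
  have "w ^ k = 1"
    by (simp add: w_def root_of_unity_power[OF assms])
  moreover have "w \<noteq> 1"
  proof
    assume "w = 1"
    then have "cos (2 * pi * real i / real k) = 1"
      unfolding w_def by (metis cis.sel(1) one_complex.sel(1))
    then obtain m :: int where "2 * pi * real i / real k = of_int m * 2 * pi"
      unfolding cos_one_2pi_int by blast
    then have "real i = of_int m * real k"
      using assms by (simp add: field_simps)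
    then have "int i = m * int k"
      by (metis (mono_tags, lifting) of_int_eq_iff of_int_mult of_int_of_nat_eq)
    then have "k dvd i"
      by (metis dvd_triv_right int_dvd_int_iff)
    with False show False ..
  qed
  ultimately show ?thesis
    using False geometric_sum[of w k] by (simp only: * if_False) simp
qed

lemma has_derivative_monomial_cnj:
  "((\<lambda>z. z ^ a * cnj z ^ b) has_derivative
     (\<lambda>h. (of_nat a * z ^ (a - 1) * cnj z ^ b) * h + (of_nat b * z ^ a * cnj z ^ (b - 1)) * cnj h)) (at z)"
  by (auto intro!: derivative_eq_intros simp: algebra_simps)

text \<open>The Wirtinger derivative with respect to z; the next definition is the one with respect
  to \<open>cnj z\<close>. Where an exponent is truncated at 0, its numerical factor is 0.\<close>

definition dunkl_poly_dz :: "nat \<Rightarrow> real \<Rightarrow> nat \<Rightarrow> complex \<Rightarrow> complex" where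
  "dunkl_poly_dz k l n z = (\<Sum>b\<le>n div k. szego_coeff l (n div k) b *\<^sub>R
     (of_nat (n - k * b) * z ^ (n - k * b - 1) * cnj z ^ (k * b)))"

definition dunkl_poly_dzbar :: "nat \<Rightarrow> real \<Rightarrow> nat \<Rightarrow> complex \<Rightarrow> complex" where
  "dunkl_poly_dzbar k l n z = (\<Sum>b\<le>n div k. szego_coeff l (n div k) b *\<^sub>R
     (of_nat (k * b) * z ^ (n - k * b) * cnj z ^ (k * b - 1)))"

lemma has_derivative_dunkl_poly:
  "(dunkl_poly k l n has_derivative (\<lambda>h. dunkl_poly_dz k l n z * h + dunkl_poly_dzbar k l n z * cnj h)) (at z)"
proof -
  have "((\<lambda>z. \<Sum>b\<le>n div k. szego_coeff l (n div k) b *\<^sub>R (z ^ (n - k * b) * cnj z ^ (k * b)))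
     has_derivative (\<lambda>h. \<Sum>b\<le>n div k. szego_coeff l (n div k) b *\<^sub>R
       ((of_nat (n - k * b) * z ^ (n - k * b - 1) * cnj z ^ (k * b)) * h +
        (of_nat (k * b) * z ^ (n - k * b) * cnj z ^ (k * b - 1)) * cnj h))) (at z)"
    by (intro has_derivative_sum has_derivative_scaleR_right has_derivative_monomial_cnj)
  then show ?thesis
    unfolding dunkl_poly_def[abs_def] dunkl_poly_dz_def dunkl_poly_dzbar_def sum_distrib_right
      sum.distrib[symmetric] mult_scaleR_left scaleR_right_distrib[symmetric] .
qed

section \<open>Summation over multiples of k and over antidiagonals\<close>

lemma sum_dvd_Suc:
  fixes f :: "nat \<Rightarrow> 'a::comm_monoid_add"
  assumes "k > 0"
  shows "(\<Sum>i<n. if k dvd Suc i then f i else 0) = (\<Sum>t<n div k. f (k * Suc t - 1))"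
proof (induction n)
  case (Suc n)
  show ?case
  proof (cases "k dvd Suc n")
    case True
    then have q: "Suc n div k = Suc (n div k)"
      by (metis div_Suc dvd_imp_mod_0)
    then have "k * Suc (n div k) = Suc n"
      using True by (metis dvd_mult_div_cancel)
    then have "k * Suc (n div k) - 1 = n" by simp
    then show ?thesis
      using Suc True by (simp only: q sum.lessThan_Suc if_True)
  next
    case False
    then have "Suc n div k = n div k"
      by (metis div_Suc dvd_eq_mod_eq_0)
    then show ?thesis using Suc False by simp
  qed
qed simp

lemma sum_dvd:
  fixes f :: "nat \<Rightarrow> 'a::comm_monoid_add"
  assumes "k > 0"
  shows "(\<Sum>i\<le>n. if k dvd i then f i else 0) = (\<Sum>t\<le>n div k. f (k * t))"
proof (induction n)
  case (Suc n)
  show ?case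
  proof (cases "k dvd Suc n")
    case True
    then have q: "Suc n div k = Suc (n div k)"
      by (metis div_Suc dvd_imp_mod_0)
    then have "k * Suc (n div k) = Suc n"
      using True by (metis dvd_mult_div_cancel)
    then show ?thesis
      using Suc True by (simp only: q sum.atMost_Suc if_True)
  next
    case False
    then have "Suc n div k = n div k"
      by (metis div_Suc dvd_eq_mod_eq_0)
    then show ?thesis using Suc False by simp
  qed
qed simp

lemma sum_triangle_antidiagonal:
  fixes f :: "nat \<Rightarrow> nat \<Rightarrow> 'a::comm_monoid_add"
  shows "(\<Sum>t\<le>m. \<Sum>b\<le>m - t. f t b) = (\<Sum>s\<le>m. \<Sum>b\<le>s. f (s - b) b)"
proof -
  have "(\<Sum>t\<le>m. \<Sum>b\<le>m - t. f t b) = (\<Sum>(t, b)\<in>(SIGMA t:{..m}. {..m - t}). f t b)"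
    by (simp add: sum.Sigma)
  also have "\<dots> = (\<Sum>(b, t)\<in>{(b, t). b + t \<le> m}. f t b)"
    by (rule sum.reindex_bij_witness[of _ prod.swap prod.swap]) auto
  also have "\<dots> = (\<Sum>s\<le>m. \<Sum>b\<le>s. f (s - b) b)"
    by (rule sum.triangle_reindex_eq)
  finally show ?thesis .
qed

text \<open>Multiplying \<open>W / (1 - r z)\<close> by \<open>1 / (1 - (r cnj z)^k)\<close> raises
  the remaining exponent from l to l + 1, by \<open>sum_negbin\<close> along antidiagonals.\<close>

lemma sum_dunkl_poly_shifted:
  assumes "k > 0"
  shows "(\<Sum>t\<le>n div k. cnj z ^ (k * t) * dunkl_poly k l (n - k * t) z) =
    (\<Sum>s\<le>n div k. (negbin (l + 1) s * negbin (l + 1) (n div k - s)) *\<^sub>R (z ^ (n - k * s) * cnj z ^ (k * s)))"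
proof -
  let ?q = "n div k"
  have "cnj z ^ (k * t) * dunkl_poly k l (n - k * t) z =
      (\<Sum>b\<le>?q - t. szego_coeff l (?q - t) b *\<^sub>R (z ^ (n - k * (t + b)) * cnj z ^ (k * (t + b))))"
    if "t \<le> ?q" for t
  proof -
    have q: "(n - k * t) div k = ?q - t"
      using assms div_mult_self4[of k t "n - k * t"] mult_le_of_le_div[OF that] by simp
    show ?thesis
      unfolding dunkl_poly_def q sum_distrib_left
      by (intro sum.cong refl) (simp add: diff_diff_eq distrib_left power_add mult_ac)
  qed
  then have "(\<Sum>t\<le>?q. cnj z ^ (k * t) * dunkl_poly k l (n - k * t) z) =
      (\<Sum>t\<le>?q. \<Sum>b\<le>?q - t. szego_coeff l (?q - t) b *\<^sub>R (z ^ (n - k * (t + b)) * cnj z ^ (k * (t + b))))"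
    by (intro sum.cong refl) simp
  also have "\<dots> = (\<Sum>s\<le>?q. \<Sum>b\<le>s. szego_coeff l (?q - (s - b)) b *\<^sub>R
      (z ^ (n - k * ((s - b) + b)) * cnj z ^ (k * ((s - b) + b))))"
    by (rule sum_triangle_antidiagonal)
  also have "\<dots> = (\<Sum>s\<le>?q. \<Sum>b\<le>s. (negbin l b * negbin (l + 1) (?q - s)) *\<^sub>R (z ^ (n - k * s) * cnj z ^ (k * s)))"
    by (intro sum.cong refl) (simp add: szego_coeff_def)
  also have "\<dots> = (\<Sum>s\<le>?q. (negbin (l + 1) s * negbin (l + 1) (?q - s)) *\<^sub>R (z ^ (n - k * s) * cnj z ^ (k * s)))"
    by (simp only: scaleR_sum_left[symmetric] sum_distrib_right[symmetric] sum_negbin)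
  finally show ?thesis .
qed

text \<open>Orthogonality of the roots of unity selects the powers of \<open>w * cnj z\<close> whose
  exponent is congruent to - m modulo k. The case m = 1 serves the derivative in
  \<open>cnj z\<close>, the case m = 0 the one in z.\<close>

lemma sum_dunkl_quotient:
  assumes "k > 0"
  shows "(\<Sum>j<k. cis (2 * pi * real j / real k) ^ m * dunkl_quotient k l n (cis (2 * pi * real j / real k)) z) =
    of_nat k * (\<Sum>i<n. if k dvd (m + i) then cnj z ^ i * dunkl_poly k l (n - 1 - i) z else 0)"
proof -
  have "(\<Sum>j<k. cis (2 * pi * real j / real k) ^ m * dunkl_quotient k l n (cis (2 * pi * real j / real k)) z) =
    (\<Sum>i<n. (\<Sum>j<k. cis (2 * pi * real j / real k) ^ (m + i)) * (cnj z ^ i * dunkl_poly k l (n - 1 - i) z))"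
    unfolding dunkl_quotient_def sum_distrib_left sum_distrib_right
    by (subst sum.swap) (simp add: power_add power_mult_distrib mult_ac)
  also have "\<dots> = of_nat k * (\<Sum>i<n. if k dvd (m + i) then cnj z ^ i * dunkl_poly k l (n - 1 - i) z else 0)"
    unfolding sum_roots_of_unity_power[OF assms] sum_distrib_left by (intro sum.cong refl) auto
  finally show ?thesis .
qed

text \<open>This says that D_1 + i D_2 annihilates \<phi>_n: for a root v the quotient contributes 2
  v^2 = - 2 w times \<open>dunkl_quotient\<close>. Both sides are coefficients of l k r^k
  \<open>cnj z\<close>^(k-1) / (1 - (r \<open>cnj z\<close>)^k) times
  \<open>W / (1 - r z)\<close>.\<close>

lemma dunkl_poly_dzbar_eq:
  assumes "k > 0"
  shows "dunkl_poly_dzbar k l n z = of_real l *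
    (\<Sum>j<k. cis (2 * pi * real j / real k) * dunkl_quotient k l n (cis (2 * pi * real j / real k)) z)"
proof (cases "n div k")
  case 0
  then have "n < k" using assms by (simp add: div_eq_0_iff)
  then have "(if k dvd (1 + i) then cnj z ^ i * dunkl_poly k l (n - 1 - i) z else 0) = 0" if "i < n" for i
    using that by (auto dest: dvd_imp_le)
  then show ?thesis
    using sum_dunkl_quotient[OF assms, of 1 l n z] by (simp add: dunkl_poly_dzbar_def 0)
next
  case (Suc q)
  have "n \<ge> k"
    using Suc assms by (metis div_less not_less nat.simps(3))
  have q: "(n - k) div k = q"
    using Suc assms \<open>n \<ge> k\<close> by (simp add: le_div_geq)
  \<comment> \<open>Differentiating \<open>(1 - X) powr (- l)\<close> brings down l and raises the
    exponent to l + 1.\<close>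
  have S: "l * (negbin (l + 1) s * negbin (l + 1) (q - s)) = real (Suc s) * szego_coeff l (Suc q) (Suc s)" for s
    by (simp only: mult.assoc[symmetric] szego_coeff_def Suc_negbin_Suc' diff_Suc_Suc)
  have "of_real l * (\<Sum>j<k. cis (2 * pi * real j / real k) * dunkl_quotient k l n (cis (2 * pi * real j / real k)) z) =
     of_real l * (of_nat k * (\<Sum>i<n. if k dvd Suc i then cnj z ^ i * dunkl_poly k l (n - 1 - i) z else 0))"
    using sum_dunkl_quotient[OF assms, of 1 l n z] by simp
  also have "(\<Sum>i<n. if k dvd Suc i then cnj z ^ i * dunkl_poly k l (n - 1 - i) z else 0) =
     (\<Sum>t\<le>q. cnj z ^ (k * Suc t - 1) * dunkl_poly k l (n - 1 - (k * Suc t - 1)) z)"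
    unfolding sum_dvd_Suc[OF assms] Suc lessThan_Suc_atMost ..
  also have "\<dots> = cnj z ^ (k - 1) * (\<Sum>t\<le>q. cnj z ^ (k * t) * dunkl_poly k l (n - k - k * t) z)"
  proof -
    have "k * Suc t - 1 = (k - 1) + k * t" "n - 1 - (k * Suc t - 1) = n - k - k * t" for t
      using assms by auto
    then show ?thesis
      by (simp only: power_add sum_distrib_left mult.assoc)
  qed
  also have "of_real l * (of_nat k * \<dots>) =
     (\<Sum>s\<le>q. (l * (negbin (l + 1) s * negbin (l + 1) (q - s))) *\<^sub>R
        (of_nat k * (z ^ (n - k * Suc s) * cnj z ^ (k * Suc s - 1))))"
  proof -
    have "k * Suc s - 1 = (k - 1) + k * s" "n - k * Suc s = n - k - k * s" for s
      using assms by auto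
    then show ?thesis
      unfolding sum_dunkl_poly_shifted[OF assms, of z l "n - k", unfolded q] sum_distrib_left
      by (intro sum.cong refl) (simp add: scaleR_conv_of_real power_add mult_ac)
  qed
  also have "\<dots> = (\<Sum>s\<le>q. szego_coeff l (Suc q) (Suc s) *\<^sub>R
        (of_nat (k * Suc s) * z ^ (n - k * Suc s) * cnj z ^ (k * Suc s - 1)))"
    unfolding S by (intro sum.cong refl) (simp add: scaleR_conv_of_real mult_ac del: of_nat_Suc mult_Suc_right)
  also have "\<dots> = dunkl_poly_dzbar k l n z"
    unfolding dunkl_poly_dzbar_def Suc by (subst sum.atMost_Suc_shift) simp
  finally show ?thesis ..
qed

text \<open>The constant c_n in D_1 \<phi>_n = c_n \<phi>_(n-1).\<close>

definition dunkl_factor :: "nat \<Rightarrow> real \<Rightarrow> nat \<Rightarrow> real" where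
  "dunkl_factor k l n = real n + (if k dvd n then 2 else 1) * real k * l"

text \<open>The left side is half of D_1 - i D_2 applied to \<phi>_(n+1), because v times its
  conjugate is 1. Together with \<open>dunkl_poly_dzbar_eq\<close> it gives both Dunkl
  operators.\<close>

lemma dunkl_poly_dz_eq:
  assumes "k > 0"
  shows "dunkl_poly_dz k l (Suc n) z + of_real l *
    (\<Sum>j<k. dunkl_quotient k l (Suc n) (cis (2 * pi * real j / real k)) z) =
    of_real (dunkl_factor k l (Suc n)) * dunkl_poly k l n z"
proof -
  let ?q = "n div k"
  define mono where "mono s = z ^ (n - k * s) * cnj z ^ (k * s)" for s
  have quot: "of_real l * (\<Sum>j<k. dunkl_quotient k l (Suc n) (cis (2 * pi * real j / real k)) z) =
     (\<Sum>s\<le>?q. (real k * (l + real s) * szego_coeff l ?q s) *\<^sub>R mono s)"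
  proof -
    have "(\<Sum>j<k. dunkl_quotient k l (Suc n) (cis (2 * pi * real j / real k)) z) =
       of_nat k * (\<Sum>i\<le>n. if k dvd i then cnj z ^ i * dunkl_poly k l (n - i) z else 0)"
      using sum_dunkl_quotient[OF assms, of 0 l "Suc n" z]
      by (simp only: lessThan_Suc_atMost diff_Suc_1 add_0 power_0 mult_1 cong: if_cong)
    also have "\<dots> = of_nat k * (\<Sum>s\<le>?q. (negbin (l + 1) s * negbin (l + 1) (?q - s)) *\<^sub>R mono s)"
      unfolding sum_dvd[OF assms] sum_dunkl_poly_shifted[OF assms] mono_def ..
    finally have *: "of_real l * (\<Sum>j<k. dunkl_quotient k l (Suc n) (cis (2 * pi * real j / real k)) z) =
       (\<Sum>s\<le>?q. (real k * (l * negbin (l + 1) s) * negbin (l + 1) (?q - s)) *\<^sub>R mono s)"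
      by (simp add: sum_distrib_left scaleR_conv_of_real mult_ac)
    show ?thesis
      unfolding * mult_negbin_plus1 by (simp add: szego_coeff_def mult.assoc)
  qed
  have le: "k * s \<le> n" if "s \<le> ?q" for s using that by (rule mult_le_of_le_div)
  have dz: "dunkl_poly_dz k l (Suc n) z =
     (\<Sum>s\<le>?q. (real (Suc n - k * s) * szego_coeff l (Suc n div k) s) *\<^sub>R mono s)"
  proof -
    have *: "szego_coeff l q s *\<^sub>R (of_nat (Suc n - k * s) * z ^ (Suc n - k * s - 1) * cnj z ^ (k * s)) =
       (real (Suc n - k * s) * szego_coeff l q s) *\<^sub>R mono s" for q s
      by (simp add: mono_def scaleR_conv_of_real mult_ac)
    show ?thesis
    proof (cases "k dvd Suc n")
      case True
      then have q: "Suc n div k = Suc ?q"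
        by (metis div_Suc dvd_imp_mod_0)
      \<comment> \<open>The sum for \<open>Suc n\<close> has one more summand here, with factor
        \<open>Suc n - k * Suc ?q = 0\<close>.\<close>
      then have "k * Suc ?q = Suc n"
        using True by (metis dvd_mult_div_cancel)
      then show ?thesis
        unfolding dunkl_poly_dz_def * q by simp
    next
      case False
      then have "Suc n div k = ?q"
        by (metis div_Suc dvd_eq_mod_eq_0)
      then show ?thesis unfolding dunkl_poly_dz_def * by simp
    qed
  qed
  have coeff: "real (Suc n - k * s) * szego_coeff l (Suc n div k) s + real k * (l + real s) * szego_coeff l ?q s =
     dunkl_factor k l (Suc n) * szego_coeff l ?q s" if "s \<le> ?q" for s
  proof (cases "k dvd Suc n")
    case True
    then have q: "Suc n div k = Suc ?q"
      by (metis div_Suc dvd_imp_mod_0)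
    then have n: "Suc n = k * Suc ?q"
      using True by (metis dvd_mult_div_cancel)
    have "Suc n - k * s = k * Suc (?q - s)"
      unfolding n diff_mult_distrib2[symmetric] using that by (simp only: Suc_diff_le)
    then have "real (Suc n - k * s) = real k * real (Suc (?q - s))"
      by (simp only: of_nat_mult)
    then have "real (Suc n - k * s) * szego_coeff l (Suc ?q) s =
       real k * negbin l s * (real (Suc (?q - s)) * negbin (l + 1) (Suc (?q - s)))"
      using that by (simp add: szego_coeff_def Suc_diff_le del: of_nat_Suc)
    also have "\<dots> = real k * (l + 1 + real (?q - s)) * szego_coeff l ?q s"
      unfolding Suc_negbin_Suc by (simp add: szego_coeff_def mult_ac)
    finally have 1: "real (Suc n - k * s) * szego_coeff l (Suc n div k) s = real k * (l + 1 + real (?q - s)) * szego_coeff l ?q s"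
      unfolding q .
    have "dunkl_factor k l (Suc n) = real k * (l + 1 + real (?q - s)) + real k * (l + real s)"
      unfolding dunkl_factor_def if_P[OF True] n using that by (simp add: of_nat_diff algebra_simps)
    then show ?thesis unfolding 1 by (simp only: distrib_right)
  next
    case False
    then have "Suc n div k = ?q"
      by (metis div_Suc dvd_eq_mod_eq_0)
    moreover have "real (Suc n - k * s) = real (Suc n) - real k * real s"
      using le[OF that] by (simp add: of_nat_diff)
    ultimately show ?thesis
      unfolding dunkl_factor_def if_not_P[OF False] by (simp only:) (simp add: algebra_simps)
  qed
  have "dunkl_poly_dz k l (Suc n) z + of_real l *
    (\<Sum>j<k. dunkl_quotient k l (Suc n) (cis (2 * pi * real j / real k)) z) =
    (\<Sum>s\<le>?q. (dunkl_factor k l (Suc n) * szego_coeff l ?q s) *\<^sub>R mono s)"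
    unfolding dz quot sum.distrib[symmetric] scaleR_add_left[symmetric]
    by (intro sum.cong refl) (simp only: coeff atMost_iff)
  also have "\<dots> = of_real (dunkl_factor k l (Suc n)) * dunkl_poly k l n z"
    by (simp add: dunkl_poly_def mono_def sum_distrib_left scaleR_conv_of_real mult_ac)
  finally show ?thesis .
qed

section \<open>Harmonicity\<close>

definition cplx :: "real ^ 2 \<Rightarrow> complex" where
  "cplx x = Complex (x $ 1) (x $ 2)"

lemma Re_cplx [simp]: "Re (cplx x) = x $ 1" and Im_cplx [simp]: "Im (cplx x) = x $ 2"
  by (simp_all add: cplx_def)

lemma bounded_linear_cplx: "bounded_linear cplx"
proof -
  have "linear cplx"
    by (rule linearI) (simp_all add: complex_eq_iff)
  then show ?thesis
    by (simp add: linear_conv_bounded_linear)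
qed

lemma cplx_reflect: "norm v = 1 \<Longrightarrow> cplx (reflect v x) = - (cplx v)\<^sup>2 * cnj (cplx x)"
proof -
  assume "norm v = 1"
  then have "v $ 1 * v $ 1 + v $ 2 * v $ 2 = 1"
    by (simp add: norm_eq_1 inner_vec_def sum_2)
  then show ?thesis
    by (simp add: complex_eq_iff reflect_def inner_vec_def sum_2 power2_eq_square) algebra
qed

lemma cplx_diff_reflect: "cplx x - cplx (reflect v x) = of_real (2 * (x \<bullet> v)) * cplx v"
  by (simp add: complex_eq_iff reflect_def)

lemma cplx_circle_point: "cplx (circle_point t) = cis t"
  by (simp add: complex_eq_iff circle_point_def)

lemma cplx_dihedral_root: "cplx (dihedral_root k j) = - \<i> * cis (real j * pi / real k)"
  by (simp add: complex_eq_iff dihedral_root_def)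

lemma norm_dihedral_root: "norm (dihedral_root k j) = 1"
  by (simp add: norm_eq_1 inner_vec_def sum_2 dihedral_root_def flip: power2_eq_square)

lemma dihedral_root_square: "- (cplx (dihedral_root k j))\<^sup>2 = cis (2 * pi * real j / real k)"
  by (simp add: cplx_dihedral_root power2_eq_square cis_mult mult_ac)

definition dunkl_re :: "nat \<Rightarrow> real \<Rightarrow> nat \<Rightarrow> complex \<Rightarrow> real ^ 2 \<Rightarrow> real" where
  "dunkl_re k l n d x = Re (d * dunkl_poly k l n (cplx x))"

lemma has_derivative_dunkl_re:
  "(dunkl_re k l n d has_derivative (\<lambda>h. Re (d * (dunkl_poly_dz k l n (cplx x) * cplx h +
     dunkl_poly_dzbar k l n (cplx x) * cnj (cplx h))))) (at x)"
proof -
  have "((\<lambda>x. dunkl_poly k l n (cplx x)) has_derivative (\<lambda>h. dunkl_poly_dz k l n (cplx x) * cplx h +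
     dunkl_poly_dzbar k l n (cplx x) * cnj (cplx h))) (at x)"
    using has_derivative_compose[OF bounded_linear_imp_has_derivative[OF bounded_linear_cplx] has_derivative_dunkl_poly] .
  then show ?thesis
    unfolding dunkl_re_def[abs_def]
    by (intro has_derivative_Re has_derivative_mult_right)
qed

text \<open>Makes the filter in \<open>reflection_quotient\<close> nontrivial, so that
  \<open>Lim\<close> has a unique value on the mirror as well.\<close>

lemma islimpt_hyperplane_complement:
  fixes v :: "'a::real_inner"
  assumes "norm v = 1"
  shows "x islimpt {z. z \<bullet> v \<noteq> 0}"
  unfolding islimpt_approachable
proof (intro allI impI)
  fix e :: real assume "e > 0"
  obtain t where t: "0 < t" "t < e" "t \<noteq> - (x \<bullet> v)"
  proof (cases "e / 2 = - (x \<bullet> v)")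
    case True
    then show ?thesis using that[of "e / 3"] \<open>e > 0\<close> by auto
  next
    case False
    then show ?thesis using that[of "e / 2"] \<open>e > 0\<close> by auto
  qed
  have "v \<noteq> 0" "v \<bullet> v = 1" using assms by (auto simp: norm_eq_1)
  then show "\<exists>x'\<in>{z. z \<bullet> v \<noteq> 0}. x' \<noteq> x \<and> dist x' x < e"
    using t assms by (intro bexI[of _ "x + t *\<^sub>R v"]) (auto simp: inner_add_left dist_norm)
qed

lemma isCont_dunkl_poly: "isCont (dunkl_poly k l n) z"
  using has_derivative_continuous[OF has_derivative_dunkl_poly] .

text \<open>Off the mirror, \<open>z - w * cnj z\<close> is 2 (z \<bullet> v) v and the scalar
  product cancels. The resulting function is continuous everywhere, hence it is also the limit on
  the mirror.\<close>

lemma reflection_quotient_dunkl_re: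
  assumes "k > 0"
  shows "reflection_quotient (dihedral_root k j) (dunkl_re k l n d) x =
    Re (d * (2 * cplx (dihedral_root k j) * dunkl_quotient k l n (cis (2 * pi * real j / real k)) (cplx x)))"
proof -
  let ?v = "dihedral_root k j" and ?w = "cis (2 * pi * real j / real k)"
  let ?F = "at x within {z. z \<bullet> ?v \<noteq> 0}"
  let ?G = "\<lambda>x. Re (d * (2 * cplx ?v * dunkl_quotient k l n ?w (cplx x)))"
  have refl: "cplx (reflect ?v z) = ?w * cnj (cplx z)" for z
    using cplx_reflect[OF norm_dihedral_root] by (simp only: dihedral_root_square)
  have "dunkl_re k l n d z - dunkl_re k l n d (reflect ?v z) = (z \<bullet> ?v) * ?G z" for z
  proof -
    have "dunkl_re k l n d z - dunkl_re k l n d (reflect ?v z) =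
       Re (d * (dunkl_poly k l n (cplx z) - dunkl_poly k l n (?w * cnj (cplx z))))"
      by (simp add: dunkl_re_def refl right_diff_distrib)
    also have "\<dots> = Re (of_real (z \<bullet> ?v) * (d * (2 * cplx ?v * dunkl_quotient k l n ?w (cplx z))))"
      unfolding dunkl_poly_reflect[OF assms root_of_unity_power[OF assms] norm_cis]
      unfolding refl[symmetric] cplx_diff_reflect by (simp only: of_real_mult of_real_numeral mult_ac)
    moreover have "Re (of_real a * c) = a * Re c" for a c by simp
    ultimately show ?thesis by (simp only:)
  qed
  then have "\<forall>\<^sub>F z in ?F. ?G z = (dunkl_re k l n d z - dunkl_re k l n d (reflect ?v z)) / (z \<bullet> ?v)"
    by (simp add: eventually_at_filter)
  moreover have "(cplx \<longlongrightarrow> cplx x) ?F"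
    by (rule bounded_linear.tendsto[OF bounded_linear_cplx tendsto_ident_at])
  then have "(?G \<longlongrightarrow> ?G x) ?F"
    unfolding dunkl_quotient_def
    by - (rule tendsto_intros isCont_tendsto_compose[OF isCont_dunkl_poly] | assumption)+
  ultimately have "((\<lambda>z. (dunkl_re k l n d z - dunkl_re k l n d (reflect ?v z)) / (z \<bullet> ?v)) \<longlongrightarrow> ?G x) ?F"
    by (rule Lim_transform_eventually[rotated])
  moreover have "?F \<noteq> bot"
    using islimpt_hyperplane_complement[OF norm_dihedral_root] by (simp add: trivial_limit_within)
  ultimately show ?thesis
    unfolding reflection_quotient_def by (rule tendsto_Lim[rotated])
qed

lemma sum_reflection_quotient_dunkl_re:
  assumes "k > 0"
  shows "(\<Sum>j<k. reflection_quotient (dihedral_root k j) (dunkl_re k l n d) x * dihedral_root k j $ i) =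
    Re (d * (\<Sum>j<k. of_real (2 * dihedral_root k j $ i) * cplx (dihedral_root k j) *
       dunkl_quotient k l n (cis (2 * pi * real j / real k)) (cplx x)))"
proof -
  have "Re c * a = Re (of_real a * c)" for a c by simp
  then show ?thesis
    unfolding reflection_quotient_dunkl_re[OF assms] sum_distrib_left Re_sum
    by (simp only: of_real_mult of_real_numeral mult_ac)
qed

text \<open>Write the coordinates as real and imaginary part of the complex root v and use that v
  has modulus 1 and v^2 = - w. This brings the sums into the form of
  \<open>dunkl_poly_dzbar_eq\<close> and \<open>dunkl_poly_dz_eq\<close>.\<close>

lemma dihedral_root_coords:
  "of_real (2 * dihedral_root k j $ 1) * cplx (dihedral_root k j) = 1 - cis (2 * pi * real j / real k)"
  "of_real (2 * dihedral_root k j $ 2) * cplx (dihedral_root k j) = \<i> * (1 + cis (2 * pi * real j / real k))"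
proof -
  let ?v = "cplx (dihedral_root k j)"
  have "norm ?v = 1"
    by (simp add: cplx_dihedral_root norm_mult)
  then have 1: "?v * cnj ?v = 1"
    by (simp only: complex_norm_square[symmetric]) simp
  have w: "cis (2 * pi * real j / real k) = - (?v * ?v)"
    by (simp only: dihedral_root_square[symmetric] power2_eq_square)
  have "of_real (2 * dihedral_root k j $ 1) = ?v + cnj ?v"
    by (rule complex_eqI) simp_all
  then show "of_real (2 * dihedral_root k j $ 1) * ?v = 1 - cis (2 * pi * real j / real k)"
  proof -
    have "(a + b) * a = a * b - - (a * a)" for a b :: complex
      by (simp add: algebra_simps)
    from this[of ?v "cnj ?v", unfolded 1] show ?thesis
      by (simp only: w \<open>of_real (2 * dihedral_root k j $ 1) = ?v + cnj ?v\<close>)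
  qed
  have "of_real (2 * dihedral_root k j $ 2) = - \<i> * (?v - cnj ?v)"
    by (rule complex_eqI) simp_all
  then show "of_real (2 * dihedral_root k j $ 2) * ?v = \<i> * (1 + cis (2 * pi * real j / real k))"
  proof -
    have "- \<i> * (a - b) * a = \<i> * (a * b + - (a * a))" for a b :: complex
      by (simp add: algebra_simps)
    from this[of ?v "cnj ?v", unfolded 1] show ?thesis
      by (simp only: w \<open>of_real (2 * dihedral_root k j $ 2) = - \<i> * (?v - cnj ?v)\<close>)
  qed
qed

text \<open>In both operators the part of the quotients with factor w cancels the derivative in
  \<open>cnj z\<close>. What remains is \<open>dunkl_poly_dz_eq\<close>, multiplied by i for
  D_2.\<close>

lemma dunkl_dunkl_re_Suc:
  assumes "k > 0"
  shows "dunkl k l 1 (dunkl_re k l (Suc n) d) = dunkl_re k l n (d * of_real (dunkl_factor k l (Suc n)))"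
    and "dunkl k l 2 (dunkl_re k l (Suc n) d) = dunkl_re k l n (\<i> * d * of_real (dunkl_factor k l (Suc n)))"
proof -
  have frechet: "frechet_derivative (dunkl_re k l (Suc n) d) (at x) h =
      Re (d * (dunkl_poly_dz k l (Suc n) (cplx x) * cplx h + dunkl_poly_dzbar k l (Suc n) (cplx x) * cnj (cplx h)))" for x h
    by (rule fun_cong[OF frechet_derivative_at[OF has_derivative_dunkl_re], symmetric])
  have axis: "cplx (axis 1 1) = 1" "cplx (axis 2 1) = \<i>"
    by (simp_all add: complex_eq_iff axis_def)
  let ?w = "\<lambda>j. cis (2 * pi * real j / real k)"
  let ?c = "complex_of_real (dunkl_factor k l (Suc n))"
  have Re_combine: "Re a + l * Re c = Re (a + of_real l * c)" for a c by simp
  note dz = dunkl_poly_dz_eq[OF assms, of l n] and dzbar = dunkl_poly_dzbar_eq[OF assms, of l "Suc n"]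
  show "dunkl k l 1 (dunkl_re k l (Suc n) d) = dunkl_re k l n (d * ?c)"
  proof
    fix x
    let ?z = "cplx x"
    let ?Q = "\<lambda>j. dunkl_quotient k l (Suc n) (?w j) ?z"
    have "dunkl k l 1 (dunkl_re k l (Suc n) d) x = Re (d * (dunkl_poly_dz k l (Suc n) ?z + dunkl_poly_dzbar k l (Suc n) ?z)
        + of_real l * (d * (\<Sum>j<k. (1 - ?w j) * ?Q j)))"
      unfolding dunkl_def frechet sum_reflection_quotient_dunkl_re[OF assms] dihedral_root_coords axis
      by (simp only: Re_combine complex_cnj_one mult_1_right)
    also have "d * (dunkl_poly_dz k l (Suc n) ?z + dunkl_poly_dzbar k l (Suc n) ?z)
        + of_real l * (d * (\<Sum>j<k. (1 - ?w j) * ?Q j)) =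
        d * (dunkl_poly_dz k l (Suc n) ?z + of_real l * (\<Sum>j<k. ?Q j))"
    proof -
      have "(\<Sum>j<k. (1 - ?w j) * ?Q j) = (\<Sum>j<k. ?Q j) - (\<Sum>j<k. ?w j * ?Q j)"
        by (simp only: left_diff_distrib sum_subtractf mult_1)
      moreover have "d * (a + e * B) + e * (d * (A - B)) = d * (a + e * A)" for a e A B :: complex
        by (simp add: algebra_simps)
      ultimately show ?thesis
        by (simp only: dzbar)
    qed
    also have "\<dots> = d * ?c * dunkl_poly k l n ?z"
      unfolding dz by (simp only: mult.assoc)
    finally show "dunkl k l 1 (dunkl_re k l (Suc n) d) x = dunkl_re k l n (d * ?c) x"
      unfolding dunkl_re_def[of k l n] .
  qed
  show "dunkl k l 2 (dunkl_re k l (Suc n) d) = dunkl_re k l n (\<i> * d * ?c)"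
  proof
    fix x
    let ?z = "cplx x"
    let ?Q = "\<lambda>j. dunkl_quotient k l (Suc n) (?w j) ?z"
    have "dunkl k l 2 (dunkl_re k l (Suc n) d) x = Re (d * (dunkl_poly_dz k l (Suc n) ?z * \<i> - dunkl_poly_dzbar k l (Suc n) ?z * \<i>)
        + of_real l * (d * (\<Sum>j<k. (\<i> * (1 + ?w j)) * ?Q j)))"
      unfolding dunkl_def frechet sum_reflection_quotient_dunkl_re[OF assms] dihedral_root_coords axis
      by (simp only: Re_combine complex_cnj_i mult_minus_right add_uminus_conv_diff)
    also have "d * (dunkl_poly_dz k l (Suc n) ?z * \<i> - dunkl_poly_dzbar k l (Suc n) ?z * \<i>)
        + of_real l * (d * (\<Sum>j<k. (\<i> * (1 + ?w j)) * ?Q j)) =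
        \<i> * d * (dunkl_poly_dz k l (Suc n) ?z + of_real l * (\<Sum>j<k. ?Q j))"
    proof -
      have "(\<Sum>j<k. (\<i> * (1 + ?w j)) * ?Q j) = \<i> * ((\<Sum>j<k. ?Q j) + (\<Sum>j<k. ?w j * ?Q j))"
        by (simp only: mult.assoc distrib_right sum.distrib sum_distrib_left[symmetric] mult_1)
      moreover have "d * (a * \<i> - e * B * \<i>) + e * (d * (\<i> * (A + B))) = \<i> * d * (a + e * A)"
        for a e A B :: complex
        by (simp add: algebra_simps)
      ultimately show ?thesis
        by (simp only: dzbar)
    qed
    also have "\<dots> = \<i> * d * ?c * dunkl_poly k l n ?z"
      unfolding dz by (simp only: mult.assoc)
    finally show "dunkl k l 2 (dunkl_re k l (Suc n) d) x = dunkl_re k l n (\<i> * d * ?c) x"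
      unfolding dunkl_re_def[of k l n] .
  qed
qed


lemma dunkl_dunkl_re_0: "dunkl k l i (dunkl_re k l 0 d) x = 0"
proof -
  have c: "dunkl_re k l 0 d = (\<lambda>x. Re d)"
    by (simp add: fun_eq_iff dunkl_re_def)
  have "reflection_quotient (dihedral_root k j) (\<lambda>x. Re d) x = 0" for j
    unfolding reflection_quotient_def
    using islimpt_hyperplane_complement[OF norm_dihedral_root]
    by (intro tendsto_Lim) (simp_all add: trivial_limit_within)
  then show ?thesis
    unfolding dunkl_def c by (simp add: frechet_derivative_const)
qed

text \<open>D_2 acts as D_1 followed by multiplication of d by i, so the sum of squares carries 1 +
  i^2 = 0. In degrees 0 and 1 the second application meets a constant.\<close>

lemma h_laplacian_dunkl_re:
  assumes "k > 0"
  shows "h_laplacian k l (dunkl_re k l n d) x = 0"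
proof (cases n)
  case 0
  have "dunkl k l i (dunkl_re k l n d) = dunkl_re k l 0 0" for i
    by (simp add: 0 fun_eq_iff dunkl_dunkl_re_0) (simp add: dunkl_re_def)
  then show ?thesis
    unfolding h_laplacian_def by (simp add: dunkl_dunkl_re_0)
next
  case (Suc m)
  show ?thesis
  proof (cases m)
    case 0
    then show ?thesis
      unfolding h_laplacian_def Suc dunkl_dunkl_re_Suc[OF assms] by (simp add: dunkl_dunkl_re_0)
  next
    case (Suc m')
    then show ?thesis
      unfolding h_laplacian_def \<open>n = Suc m\<close> Suc dunkl_dunkl_re_Suc[OF assms]
      by (simp add: dunkl_re_def mult.assoc[symmetric])
  qed
qed

text \<open>Homogeneous polynomials with complex coefficients: products of \<open>z\<close> and
  \<open>cnj z\<close> stay in this class, and the real part is taken only afterwards.\<close>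

definition complex_form :: "nat \<Rightarrow> (real ^ 2 \<Rightarrow> complex) \<Rightarrow> bool" where
  "complex_form n f \<longleftrightarrow> (\<exists>a. \<forall>x. f x = (\<Sum>j\<le>n. a j * of_real ((x $ 1) ^ j * (x $ 2) ^ (n - j))))"

lemma complex_form_Re:
  assumes "complex_form n f"
  shows "homogeneous_polynomial n (\<lambda>x. Re (f x))"
proof -
  obtain a where "f x = (\<Sum>j\<le>n. a j * of_real ((x $ 1) ^ j * (x $ 2) ^ (n - j)))" for x
    using assms unfolding complex_form_def by blast
  then have "Re (f x) = (\<Sum>j\<le>n. Re (a j) * (x $ 1) ^ j * (x $ 2) ^ (n - j))" for x
    by (simp only: Re_sum Re_complex_of_real times_complex.sel Im_complex_of_real) (simp add: mult.assoc)
  then show ?thesis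
    unfolding homogeneous_polynomial_def by (intro exI[of _ "\<lambda>j. Re (a j)"] allI)
qed

lemma complex_form_sum:
  assumes "\<And>i. i \<in> I \<Longrightarrow> complex_form n (f i)"
  shows "complex_form n (\<lambda>x. \<Sum>i\<in>I. c i * f i x)"
proof -
  obtain a where a: "\<And>i x. i \<in> I \<Longrightarrow> f i x = (\<Sum>j\<le>n. a i j * of_real ((x $ 1) ^ j * (x $ 2) ^ (n - j)))"
    using assms unfolding complex_form_def by metis
  show ?thesis
    unfolding complex_form_def
  proof (intro exI allI)
    fix x
    have "(\<Sum>i\<in>I. c i * f i x) = (\<Sum>i\<in>I. \<Sum>j\<le>n. c i * (a i j * of_real ((x $ 1) ^ j * (x $ 2) ^ (n - j))))"
      by (intro sum.cong refl) (simp only: a sum_distrib_left)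
    also have "\<dots> = (\<Sum>j\<le>n. (\<Sum>i\<in>I. c i * a i j) * of_real ((x $ 1) ^ j * (x $ 2) ^ (n - j)))"
      by (subst sum.swap) (simp only: sum_distrib_right mult.assoc)
    finally show "(\<Sum>i\<in>I. c i * f i x) = (\<Sum>j\<le>n. (\<Sum>i\<in>I. c i * a i j) * of_real ((x $ 1) ^ j * (x $ 2) ^ (n - j)))" .
  qed
qed

lemma complex_form_mult_linear:
  assumes "complex_form n f"
  shows "complex_form (Suc n) (\<lambda>x. (u * of_real (x $ 1) + v * of_real (x $ 2)) * f x)"
proof -
  obtain a where a: "f x = (\<Sum>j\<le>n. a j * of_real ((x $ 1) ^ j * (x $ 2) ^ (n - j)))" for x
    using assms unfolding complex_form_def by blast
  let ?m = "\<lambda>x::real^2. \<lambda>j. complex_of_real ((x $ 1) ^ j * (x $ 2) ^ (Suc n - j))"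
  let ?b = "\<lambda>j. (if j = 0 then 0 else u * a (j - 1)) + (if j = Suc n then 0 else v * a j)"
  show ?thesis
    unfolding complex_form_def
  proof (intro exI allI)
    fix x :: "real^2"
    have "(\<Sum>j\<le>Suc n. ?b j * ?m x j) =
        (\<Sum>j\<le>Suc n. (if j = 0 then 0 else u * a (j - 1)) * ?m x j) +
        (\<Sum>j\<le>Suc n. (if j = Suc n then 0 else v * a j) * ?m x j)"
      by (simp only: distrib_right sum.distrib)
    also have "(\<Sum>j\<le>Suc n. (if j = 0 then 0 else u * a (j - 1)) * ?m x j) = u * of_real (x $ 1) * f x"
      by (subst sum.atMost_Suc_shift) (simp add: a sum_distrib_left mult_ac)
    also have "(\<Sum>j\<le>Suc n. (if j = Suc n then 0 else v * a j) * ?m x j) = (\<Sum>j\<le>n. v * a j * ?m x j)"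
      by simp
    also have "\<dots> = v * of_real (x $ 2) * f x"
      unfolding a sum_distrib_left by (intro sum.cong refl) (simp add: Suc_diff_le mult_ac)
    finally show "(u * of_real (x $ 1) + v * of_real (x $ 2)) * f x = (\<Sum>j\<le>Suc n. ?b j * ?m x j)"
      by (simp only: distrib_right)
  qed
qed

lemma complex_form_monomial: "complex_form (a + b) (\<lambda>x. cplx x ^ a * cnj (cplx x) ^ b)"
proof -
  have cnj: "1 * of_real (x $ 1) + (- \<i>) * of_real (x $ 2) = cnj (cplx x)" for x
    by (rule complex_eqI) simp_all
  have id: "1 * of_real (x $ 1) + \<i> * of_real (x $ 2) = cplx x" for x
    by (rule complex_eqI) simp_all
  have base: "complex_form b (\<lambda>x. cnj (cplx x) ^ b)"
  proof (induction b)
    case 0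
    show ?case unfolding complex_form_def by (intro exI[of _ "\<lambda>_. 1"]) simp
  next
    case (Suc b)
    show ?case
      using complex_form_mult_linear[OF Suc, of 1 "- \<i>"] by (simp only: cnj power_Suc)
  qed
  show ?thesis
  proof (induction a)
    case 0
    show ?case using base by (simp only: power_0 add_0 mult_1)
  next
    case (Suc a)
    show ?case
      using complex_form_mult_linear[OF Suc, of 1 \<i>] by (simp only: id power_Suc add_Suc mult.assoc)
  qed
qed

lemma dunkl_re_in_h_harmonics:
  assumes "k > 0"
  shows "dunkl_re k l n d \<in> h_harmonics k l n"
proof -
  let ?f = "\<lambda>x. \<Sum>b\<le>n div k. (d * of_real (szego_coeff l (n div k) b)) *
      (cplx x ^ (n - k * b) * cnj (cplx x) ^ (k * b))"
  have "complex_form n (\<lambda>x. cplx x ^ (n - k * b) * cnj (cplx x) ^ (k * b))" if "b \<le> n div k" for b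
    using complex_form_monomial[of "n - k * b" "k * b"] mult_le_of_le_div[OF that] by simp
  then have "complex_form n ?f"
    by (intro complex_form_sum) simp
  then have "homogeneous_polynomial n (\<lambda>x. Re (?f x))"
    by (rule complex_form_Re)
  moreover have "dunkl_re k l n d = (\<lambda>x. Re (?f x))"
    by (rule ext) (simp only: dunkl_re_def dunkl_poly_def scaleR_conv_of_real sum_distrib_left mult.assoc)
  ultimately have "homogeneous_polynomial n (dunkl_re k l n d)"
    by (simp only:)
  then show ?thesis
    unfolding h_harmonics_def using h_laplacian_dunkl_re[OF assms] by simp
qed

section \<open>Generating functions\<close>

lemma negbin_sums:
  fixes X :: complex
  assumes "norm X < 1"
  shows "(\<lambda>n. of_real (negbin a n) * X ^ n) sums ((1 - X) powr (- of_real a))"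
proof -
  have "((- complex_of_real a) gchoose n) * (- X) ^ n = of_real (negbin a n) * X ^ n" for n
  proof -
    have "((- complex_of_real a) gchoose n) * (- X) ^ n = ((-1) ^ n * (-1) ^ n) * (pochhammer (of_real a) n / fact n * X ^ n)"
      by (simp add: gbinomial_pochhammer power_minus[of X])
    also have "\<dots> = of_real (negbin a n) * X ^ n"
      by (simp add: negbin_def pochhammer_of_real flip: power_mult_distrib)
    finally show ?thesis .
  qed
  with gen_binomial_complex[of "- X" "- of_real a"] assms show ?thesis
    by simp
qed

lemma negbin_summable_norm:
  assumes "norm (X::complex) < 1"
  shows "summable (\<lambda>n. norm (of_real (negbin a n) * X ^ n))"
proof -
  \<comment> \<open>A radius strictly between \<open>norm X\<close> and 1; convergence there implies
    absolute convergence at X.\<close>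
  define \<rho> where "\<rho> = (1 + norm X) / 2"
  have "norm X < \<rho>" "\<rho> < 1" "0 \<le> \<rho>" using assms by (auto simp: \<rho>_def)
  then have "summable (\<lambda>n. of_real (negbin a n) * complex_of_real \<rho> ^ n)"
    using negbin_sums[of "of_real \<rho>" a] by (simp add: sums_iff)
  then show ?thesis
    by (rule powser_insidea) (use \<open>norm X < \<rho>\<close> in simp)
qed

text \<open>A positive real part keeps u off the branch cut, so that conjugation commutes with the
  power.\<close>

lemma powr_mult_cnj_powr:
  assumes "Re u > 0"
  shows "u powr of_real a * cnj u powr of_real a = of_real (((norm u)\<^sup>2) powr a)"
proof -
  have "u powr of_real a * cnj u powr of_real a = u powr of_real a * cnj (u powr of_real a)"
    using assms by (simp add: cnj_powr)
  also have "\<dots> = of_real ((norm (u powr of_real a))\<^sup>2)"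
    by (rule complex_norm_square[symmetric])
  also have "norm (u powr of_real a) = norm u powr a"
    by (simp add: norm_powr_real_powr')
  also have "(norm u powr a)\<^sup>2 = ((norm u)\<^sup>2) powr a"
    by (simp add: power2_eq_square powr_mult)
  finally show ?thesis .
qed

lemma sums_on_multiples:
  fixes c :: "'a::real_normed_vector"
  assumes "k > 0" and "(\<lambda>q. f (k * q)) sums c" and "\<And>n. \<not> k dvd n \<Longrightarrow> f n = 0"
  shows "f sums c"
proof -
  have "strict_mono (\<lambda>q. k * q)"
    using assms(1) by (simp add: strict_mono_def)
  moreover have "f n = 0" if "n \<notin> range (\<lambda>q. k * q)" for n
    using that assms(3)[of n] by (auto elim!: dvdE)
  ultimately show ?thesis
    using sums_mono_reindex[of "\<lambda>q. k * q" f c] assms(2) by simp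
qed

lemma weight_poly_sums:
  assumes "k > 0" "norm z = 1" "0 \<le> r" "r < 1"
  shows "(\<lambda>n. weight_poly k l n z * of_real r ^ n) sums
    of_real ((1 - 2 * r ^ k * Re (z ^ k) + r ^ (2 * k)) powr (- l))"
proof (rule sums_on_multiples[OF assms(1)])
  define X where "X = (of_real r * z) ^ k"
  have "norm X = r ^ k"
    using assms by (simp add: X_def norm_power norm_mult)
  then have X: "norm X < 1" "norm (cnj X) < 1"
    using assms power_less_one_iff[of r k] by simp_all
  have terms: "weight_poly k l (k * q) z * of_real r ^ (k * q) =
      (\<Sum>b\<le>q. (of_real (negbin l b) * cnj X ^ b) * (of_real (negbin l (q - b)) * X ^ (q - b)))" for q
  proof -
    have "z ^ (k * q - k * b) * cnj z ^ (k * b) * of_real r ^ (k * q) = cnj X ^ b * X ^ (q - b)" if "b \<le> q" for b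
    proof -
      have "k * q = k * b + (k * q - k * b)" using that by simp
      then have "of_real r ^ (k * q) = complex_of_real r ^ (k * b) * of_real r ^ (k * q - k * b)"
        by (metis power_add)
      then show ?thesis
        by (simp add: X_def power_mult[symmetric] power_mult_distrib diff_mult_distrib2 mult_ac)
    qed
    then have "((negbin l b * negbin l (q - b)) *\<^sub>R (z ^ (k * q - k * b) * cnj z ^ (k * b))) * of_real r ^ (k * q) =
        (of_real (negbin l b) * cnj X ^ b) * (of_real (negbin l (q - b)) * X ^ (q - b))" if "b \<le> q" for b
      using that by (simp only: scaleR_conv_of_real of_real_mult mult.assoc) (simp only: mult_ac)
    then show ?thesis
      using assms(1) by (simp only: weight_poly_def sum_distrib_right dvd_triv_left if_True
        nonzero_mult_div_cancel_left neq0_conv) (intro sum.cong refl, simp only: atMost_iff)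
  qed
  have "(\<lambda>q. weight_poly k l (k * q) z * of_real r ^ (k * q)) sums
      ((1 - cnj X) powr (- of_real l) * (1 - X) powr (- of_real l))"
    unfolding terms
    using Cauchy_product_sums[OF negbin_summable_norm[OF X(2), of l] negbin_summable_norm[OF X(1), of l]]
      sums_unique[OF negbin_sums[OF X(1), of l]] sums_unique[OF negbin_sums[OF X(2), of l]] by simp
  also have "(1 - cnj X) powr (- of_real l) * (1 - X) powr (- of_real l) = of_real (((norm (1 - X))\<^sup>2) powr (- l))"
  proof -
    have "Re (1 - X) > 0"
      using X(1) complex_Re_le_cmod[of X] by simp
    from powr_mult_cnj_powr[OF this, of "- l"] show ?thesis
      by (simp add: mult.commute)
  qed
  also have "(norm (1 - X))\<^sup>2 = 1 - 2 * r ^ k * Re (z ^ k) + r ^ (2 * k)"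
  proof -
    have "(norm (1 - X))\<^sup>2 = 1 - 2 * Re X + (norm X)\<^sup>2"
      unfolding cmod_power2 by (simp add: power2_eq_square algebra_simps)
    moreover have "Re X = r ^ k * Re (z ^ k)"
      by (simp add: X_def power_mult_distrib flip: of_real_power)
    ultimately show ?thesis
      by (simp add: \<open>norm X = r ^ k\<close> power_mult[symmetric] mult.commute)
  qed
  finally show "(\<lambda>q. weight_poly k l (k * q) z * of_real r ^ (k * q)) sums
    of_real ((1 - 2 * r ^ k * Re (z ^ k) + r ^ (2 * k)) powr (- l))" .
qed (simp add: weight_poly_def)

text \<open>All monomials have modulus 1 on the circle, so the triangle inequality bounds the series
  by that of \<open>(1 - r^k) powr (- 2 l)\<close>. Absolute convergence is required for the Cauchy
  product with the geometric series.\<close>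

lemma weight_poly_summable_norm:
  assumes "k > 0" "norm z = 1" "0 \<le> r" "r < 1" "l \<ge> 0"
  shows "summable (\<lambda>n. norm (weight_poly k l n z * of_real r ^ n))"
proof (rule summable_comparison_test')
  let ?g = "\<lambda>n. if k dvd n then negbin (2 * l) (n div k) * r ^ n else 0"
  have "r ^ k < 1" "r ^ k \<ge> 0"
    using assms power_less_one_iff[of r k] by simp_all
  then have "summable (\<lambda>q. negbin (2 * l) q * (r ^ k) ^ q)"
    using negbin_summable_norm[of "of_real (r ^ k)" "2 * l"] assms(5)
    by (simp add: norm_mult norm_power negbin_nonneg abs_of_nonneg[OF assms(3)])
  then have "(\<lambda>q. ?g (k * q)) sums (\<Sum>q. negbin (2 * l) q * (r ^ k) ^ q)"
    using assms(1) by (simp add: summable_sums power_mult)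
  from sums_on_multiples[OF assms(1) this] show "summable ?g"
    by (simp add: sums_iff)
  show "norm (norm (weight_poly k l n z * of_real r ^ n)) \<le> ?g n" if "n \<ge> 0" for n
  proof (cases "k dvd n")
    case True
    have "norm (weight_poly k l n z) \<le> (\<Sum>b\<le>n div k. norm ((negbin l b * negbin l (n div k - b)) *\<^sub>R (z ^ (n - k * b) * cnj z ^ (k * b))))"
      using True by (simp only: weight_poly_def if_True norm_sum)
    also have "\<dots> = (\<Sum>b\<le>n div k. negbin l b * negbin l (n div k - b))"
      using assms by (intro sum.cong refl) (simp add: norm_mult norm_power negbin_nonneg)
    also have "\<dots> = negbin (2 * l) (n div k)"
      by (simp add: sum_negbin_mult)
    finally show ?thesis
      using True assms by (simp add: norm_mult norm_power mult_right_mono)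
  qed (simp add: weight_poly_def)
qed

lemma dunkl_poly_eq_sum:
  assumes "k > 0"
  shows "dunkl_poly k l n z = (\<Sum>i\<le>n. z ^ i * weight_poly k l (n - i) z)"
proof (induction n)
  case 0
  then show ?case using assms by (simp add: weight_poly_def)
next
  case (Suc n)
  then show ?case
    unfolding dunkl_poly_Suc[OF assms]
    by (subst sum.atMost_Suc_shift) (simp add: sum_distrib_left mult_ac)
qed

lemma dunkl_poly_sums:
  assumes "k > 0" "norm z = 1" "0 \<le> r" "r < 1" "l \<ge> 0"
  shows "(\<lambda>n. dunkl_poly k l n z * of_real r ^ n) sums
    (of_real ((1 - 2 * r ^ k * Re (z ^ k) + r ^ (2 * k)) powr (- l)) / (1 - of_real r * z))"
proof -
  have n: "norm (of_real r * z) < 1"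
    using assms by (simp add: norm_mult)
  have "(\<lambda>n. \<Sum>i\<le>n. (of_real r * z) ^ i * (weight_poly k l (n - i) z * of_real r ^ (n - i))) sums
     ((\<Sum>n. (of_real r * z) ^ n) * (\<Sum>n. weight_poly k l n z * of_real r ^ n))"
    by (intro Cauchy_product_sums weight_poly_summable_norm assms)
      (use n in \<open>simp add: norm_power summable_geometric\<close>)
  also have "(\<lambda>n. \<Sum>i\<le>n. (of_real r * z) ^ i * (weight_poly k l (n - i) z * of_real r ^ (n - i))) =
     (\<lambda>n. dunkl_poly k l n z * of_real r ^ n)"
  proof
    fix n
    have "(of_real r * z) ^ i * (weight_poly k l (n - i) z * of_real r ^ (n - i)) =
       z ^ i * weight_poly k l (n - i) z * of_real r ^ n" if "i \<le> n" for i
      using power_add[of "complex_of_real r" i "n - i"] that by (simp add: power_mult_distrib mult_ac)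
    then show "(\<Sum>i\<le>n. (of_real r * z) ^ i * (weight_poly k l (n - i) z * of_real r ^ (n - i))) =
       dunkl_poly k l n z * of_real r ^ n"
      unfolding dunkl_poly_eq_sum[OF assms(1)] sum_distrib_right by (intro sum.cong refl) simp
  qed
  finally show ?thesis
    using n weight_poly_sums[OF assms(1-4), of l] by (simp add: sums_iff suminf_geometric)
qed

text \<open>W is real and \<open>2 / (1 - r z) - 1 = (1 + r z) / (1 - r z)\<close>, whose real part
  is the classical Poisson kernel.\<close>

lemma poisson_series_sums:
  assumes "k > 0" "norm z = 1" "0 \<le> r" "r < 1" "l \<ge> 0"
  shows "(\<lambda>n. Re (2 * dunkl_poly k l n z - weight_poly k l n z) * r ^ n) sums
    ((1 - r\<^sup>2) / ((1 - 2 * r * Re z + r\<^sup>2) * (1 - 2 * r ^ k * Re (z ^ k) + r ^ (2 * k)) powr l))"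
proof -
  let ?W = "(1 - 2 * r ^ k * Re (z ^ k) + r ^ (2 * k)) powr (- l)"
  have "(\<lambda>n. 2 * (dunkl_poly k l n z * of_real r ^ n) - weight_poly k l n z * of_real r ^ n) sums
     (2 * (of_real ?W / (1 - of_real r * z)) - of_real ?W)"
    by (intro sums_diff sums_mult dunkl_poly_sums weight_poly_sums assms)
  then have "(\<lambda>n. Re (2 * (dunkl_poly k l n z * of_real r ^ n) - weight_poly k l n z * of_real r ^ n)) sums
     Re (2 * (of_real ?W / (1 - of_real r * z)) - of_real ?W)"
    by (rule sums_Re)
  also have "(\<lambda>n. Re (2 * (dunkl_poly k l n z * of_real r ^ n) - weight_poly k l n z * of_real r ^ n)) =
     (\<lambda>n. Re (2 * dunkl_poly k l n z - weight_poly k l n z) * r ^ n)"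
    by (rule ext) (simp add: algebra_simps flip: of_real_power)
  also have "Re (2 * (of_real ?W / (1 - of_real r * z)) - of_real ?W) =
     ?W * Re ((1 + of_real r * z) / (1 - of_real r * z))"
  proof -
    have "1 - of_real r * z \<noteq> 0"
    proof
      assume "1 - of_real r * z = 0"
      then have "norm (of_real r * z) = 1" by (metis eq_iff_diff_eq_0 norm_one)
      with assms show False by (simp add: norm_mult)
    qed
    then have "2 * (of_real ?W / (1 - of_real r * z)) - of_real ?W =
       of_real ?W * ((1 + of_real r * z) / (1 - of_real r * z))"
      by (simp add: field_simps)
    moreover have "Re (of_real a * c) = a * Re c" for a c by simp
    ultimately show ?thesis by (simp only:)
  qed
  also have "Re ((1 + of_real r * z) / (1 - of_real r * z)) = (1 - r\<^sup>2) / (1 - 2 * r * Re z + r\<^sup>2)"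
  proof -
    have z: "(Re z)\<^sup>2 + (Im z)\<^sup>2 = 1"
      using assms(2) by (simp add: cmod_power2[symmetric])
    then have "(Re (1 - of_real r * z))\<^sup>2 + (Im (1 - of_real r * z))\<^sup>2 = 1 - 2 * r * Re z + r\<^sup>2"
      by (simp add: power2_eq_square) algebra
    moreover have "Re (1 + of_real r * z) * Re (1 - of_real r * z) + Im (1 + of_real r * z) * Im (1 - of_real r * z) = 1 - r\<^sup>2"
      using z by (simp add: power2_eq_square) algebra
    ultimately show ?thesis
      by (simp only: Re_divide)
  qed
  finally show ?thesis
    by (simp add: powr_minus field_simps)
qed

section \<open>Fourier coefficients of the weight\<close>

lemma finite_zeros_sin:
  assumes "k > 0"
  shows "finite {t \<in> {a..b}. sin (real k * t) = 0}"
proof (rule finite_subset)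
  show "{t \<in> {a..b}. sin (real k * t) = 0} \<subseteq>
      (\<lambda>i. of_int i * pi / real k) ` {\<lfloor>a * real k / pi\<rfloor>..\<lceil>b * real k / pi\<rceil>}"
  proof
    fix t assume t: "t \<in> {t \<in> {a..b}. sin (real k * t) = 0}"
    then obtain i :: int where i: "real k * t = of_int i * pi"
      by (auto simp: sin_zero_iff_int2)
    have "t * real k / pi = of_int i"
      using i by (simp add: field_simps)
    moreover have "a * real k / pi \<le> t * real k / pi" "t * real k / pi \<le> b * real k / pi"
      using t by (auto intro!: divide_right_mono mult_right_mono)
    ultimately have "i \<in> {\<lfloor>a * real k / pi\<rfloor>..\<lceil>b * real k / pi\<rceil>}"
      by (auto simp: floor_le_iff le_ceiling_iff)
    moreover have "t = of_int i * pi / real k"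
      using i assms by (simp add: field_simps)
    ultimately show "t \<in> (\<lambda>i. of_int i * pi / real k) ` {\<lfloor>a * real k / pi\<rfloor>..\<lceil>b * real k / pi\<rceil>}"
      by blast
  qed
qed simp

lemma continuous_on_weight_sq:
  assumes "l > 0"
  shows "continuous_on S (weight_sq k l)"
  unfolding weight_sq_def[abs_def] using assms
  by (intro continuous_on_powr' continuous_intros) auto

text \<open>For l = 0 the weight is discontinuous since \<open>0 powr 0 = 0\<close>; it differs from
  1 only at finitely many points of the interval.\<close>

lemma weight_sq_integrable:
  fixes f :: "real \<Rightarrow> 'a::euclidean_space"
  assumes "k > 0" "l \<ge> 0" "continuous_on {a..b} f"
  shows "(\<lambda>t. weight_sq k l t *\<^sub>R f t) integrable_on {a..b}"
proof (cases "l = 0")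
  case True
  show ?thesis
  proof (rule integrable_spike)
    show "f integrable_on {a..b}"
      using assms(3) by (rule integrable_continuous_real)
    show "negligible {t \<in> {a..b}. sin (real k * t) = 0}"
      by (intro negligible_finite finite_zeros_sin assms(1))
    show "weight_sq k l t *\<^sub>R f t = f t" if "t \<in> {a..b} - {t \<in> {a..b}. sin (real k * t) = 0}" for t
      using that by (simp add: weight_sq_def True)
  qed
next
  case False
  then show ?thesis
    using assms by (intro integrable_continuous_real continuous_on_scaleR continuous_on_weight_sq) auto
qed

definition weight_fourier :: "nat \<Rightarrow> real \<Rightarrow> int \<Rightarrow> complex" where
  "weight_fourier k l m = integral {0..2 * pi} (\<lambda>t. weight_sq k l t *\<^sub>R cis (of_int m * t))"

lemma weight_fourier_has_integral:
  assumes "k > 0" "l \<ge> 0"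
  shows "((\<lambda>t. weight_sq k l t *\<^sub>R cis (of_int m * t)) has_integral weight_fourier k l m) {0..2 * pi}"
  unfolding weight_fourier_def
  by (intro integrable_integral weight_sq_integrable assms continuous_intros)

lemma weight_sq_shift: "k > 0 \<Longrightarrow> weight_sq k l (t + pi / real k) = weight_sq k l t"
  by (simp add: weight_sq_def distrib_left)

lemma weight_sq_2pi: "weight_sq k l (t + 2 * pi) = weight_sq k l t"
proof -
  have "sin (real k * (t + 2 * pi)) = sin (real k * t)"
    using sin_cos_eq_iff[of "real k * (t + 2 * pi)" "real k * t"]
    by (auto simp: algebra_simps intro!: exI[of _ "int k"])
  then show ?thesis by (simp add: weight_sq_def)
qed

lemma integral_periodic_shift:
  fixes f :: "real \<Rightarrow> 'a::euclidean_space"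
  assumes "f integrable_on {0..p + a}" and "0 \<le> a" and "a \<le> p" and "\<And>t. f (t + p) = f t"
  shows "integral {0..p} (\<lambda>t. f (t + a)) = integral {0..p} f"
proof -
  have int: "f integrable_on {0..p}" "f integrable_on {a..p + a}"
    using assms by (auto intro: integrable_subinterval_real)
  have "integral {0..p} (\<lambda>t. f (t + a)) = integral {a..p + a} f"
    using integral_shift_real_ivl[of a a "p + a" f] by simp
  also have "\<dots> = integral {a..p} f + integral {p..p + a} f"
    using assms int by (intro Henstock_Kurzweil_Integration.integral_combine[symmetric]) auto
  also have "integral {p..p + a} f = integral {0..a} (\<lambda>t. f (t + p))"
    using integral_shift_real_ivl[of p p "p + a" f] by simp
  also have "\<dots> = integral {0..a} f"
    by (simp only: assms(4))
  also have "integral {a..p} f + integral {0..a} f = integral {0..p} f"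
    using assms int Henstock_Kurzweil_Integration.integral_combine[of 0 a p f] by (simp add: add.commute)
  finally show ?thesis .
qed

text \<open>Shifting by \<open>pi / k\<close> preserves the weight and multiplies the exponential by
  a constant different from 1, while the integral over a full period does not change.\<close>

lemma weight_fourier_eq_0:
  assumes "k > 0" "l \<ge> 0" and "\<not> int k dvd m"
  shows "weight_fourier k l (2 * m) = 0"
proof -
  let ?f = "\<lambda>t. weight_sq k l t *\<^sub>R cis (of_int (2 * m) * t)"
  let ?c = "cis (2 * pi * of_int m / real k)"
  have c: "?f (t + pi / real k) = ?f t * ?c" for t
    by (simp add: weight_sq_shift[OF assms(1)] cis_mult distrib_left mult_ac)
  have p: "?f (t + 2 * pi) = ?f t" for t
  proof -
    have "cis (of_int (2 * m) * (t + 2 * pi)) = cis (of_int (2 * m) * t) * cis (2 * pi * of_int (2 * m))"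
      unfolding cis_mult by (simp add: algebra_simps)
    moreover have "cis (2 * pi * of_int (2 * m)) = 1"
      by (rule cis_multiple_2pi) simp
    ultimately show ?thesis
      by (simp only: weight_sq_2pi mult_1_right)
  qed
  have "pi / real k \<le> pi / 1"
    using assms(1) by (intro divide_left_mono) auto
  then have "pi / real k \<le> 2 * pi"
    using pi_gt_zero by linarith
  then have "integral {0..2 * pi} (\<lambda>t. ?f (t + pi / real k)) = integral {0..2 * pi} ?f"
    by (intro integral_periodic_shift weight_sq_integrable assms continuous_intros p) auto
  then have "weight_fourier k l (2 * m) * ?c = weight_fourier k l (2 * m)"
    by (simp only: c weight_fourier_def integral_mult_left)
  moreover have "?c \<noteq> 1"
  proof
    assume "?c = 1"
    then have "cos (2 * pi * real_of_int m / real k) = 1"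
      by (metis cis.sel(1) one_complex.sel(1))
    then obtain i :: int where "2 * pi * real_of_int m / real k = of_int i * 2 * pi"
      unfolding cos_one_2pi_int by blast
    then have "real_of_int m = of_int i * real k"
      using assms(1) by (simp add: field_simps)
    then have "m = i * int k"
      by (metis (mono_tags, lifting) of_int_eq_iff of_int_mult of_int_of_nat_eq)
    with assms(3) show False by simp
  qed
  ultimately show ?thesis by simp
qed

section \<open>A first-order recurrence for the Fourier coefficients\<close>

lemma DERIV_mult_abs_powr:
  assumes "u \<noteq> 0"
  shows "((\<lambda>u. u * \<bar>u\<bar> powr a) has_real_derivative (a + 1) * \<bar>u\<bar> powr a) (at u)"
proof -
  have pos: "((\<lambda>u. u * \<bar>u\<bar> powr a) has_real_derivative (a + 1) * \<bar>u\<bar> powr a) (at u)" if "u > 0" for u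
  proof (rule has_field_derivative_transform_within_open)
    show "((\<lambda>u. u * u powr a) has_real_derivative (a + 1) * \<bar>u\<bar> powr a) (at u)"
      using that by (auto intro!: derivative_eq_intros simp: powr_diff field_simps)
    show "open {0::real<..}" "u \<in> {0<..}" using that by auto
  qed simp
  show ?thesis
  proof (cases "u > 0")
    case False
    then have "((\<lambda>u. - ((- u) * \<bar>- u\<bar> powr a)) has_real_derivative - ((a + 1) * \<bar>- u\<bar> powr a * (- 1))) (at u)"
      using assms by (intro DERIV_minus DERIV_chain2[OF pos]) (auto intro!: derivative_eq_intros)
    then show ?thesis by simp
  qed (rule pos)
qed

text \<open>For a = 0 the value \<open>0 powr 0 = 0\<close> is masked by the factor u.\<close>

lemma continuous_on_mult_abs_powr:
  assumes "a \<ge> 0"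
  shows "continuous_on S (\<lambda>u::real. u * \<bar>u\<bar> powr a)"
proof (cases "a = 0")
  case True
  have "continuous_on S (\<lambda>u::real. u)" by (rule continuous_on_id)
  then show ?thesis by (rule continuous_on_eq) (simp add: True)
next
  case False
  then show ?thesis
    using assms by (intro continuous_on_mult continuous_on_powr' continuous_intros) auto
qed

text \<open>The derivative of \<open>(\<zeta> - 1) \<zeta> ^ m |\<zeta> - 1| powr (2 l)\<close> with \<open>\<zeta> = cis (2 k t)\<close> integrates to 0 over a period.\<close>

lemma weight_fourier_recurrence:
  assumes "k > 0" "l \<ge> 0"
  shows "of_real (of_int m + 1 + l) * weight_fourier k l (2 * int k * (m + 1)) =
     of_real (of_int m - l) * weight_fourier k l (2 * int k * m)"
proof -
  \<comment> \<open>Since \<open>\<zeta> - 1 = 2 * \<i> * sin (k t) * cis (k t)\<close>, the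
    function described above is \<open>?H\<close> up to a constant factor.\<close>
  let ?N = "(2 * of_int m + 1) * real k"
  let ?\<sigma> = "\<lambda>u::real. u * \<bar>u\<bar> powr (2 * l)"
  let ?H = "\<lambda>t. cis (?N * t) * of_real (?\<sigma> (sin (real k * t)))"
  let ?H' = "\<lambda>t. of_real (real k) * (of_real (of_int m + 1 + l) * (weight_sq k l t *\<^sub>R cis (of_int (2 * int k * (m + 1)) * t))
        - of_real (of_int m - l) * (weight_sq k l t *\<^sub>R cis (of_int (2 * int k * m) * t)))"
  have "(?H' has_integral (?H (2 * pi) - ?H 0)) {0..2 * pi}"
  \<comment> \<open>The derivative is computed away from the finitely many zeros of the sine; at
    these, continuity of \<open>?H\<close> suffices.\<close>
  proof (rule fundamental_theorem_of_calculus_interior_strong[OF finite_zeros_sin[OF assms(1), of 0 "2 * pi"]])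
    show "continuous_on {0..2 * pi} ?H"
    proof -
      have "continuous_on {0..2 * pi} (\<lambda>t. sin (real k * t))"
        by (intro continuous_intros)
      with continuous_on_mult_abs_powr[of "2 * l" UNIV] assms(2)
      have "continuous_on {0..2 * pi} (\<lambda>t. ?\<sigma> (sin (real k * t)))"
        by (intro continuous_on_compose2[of UNIV ?\<sigma> _ "\<lambda>t. sin (real k * t)"]) auto
      then have "continuous_on {0..2 * pi} (\<lambda>t. complex_of_real (?\<sigma> (sin (real k * t))))"
        by (rule continuous_on_of_real)
      moreover have "continuous_on {0..2 * pi} (\<lambda>t. cis (?N * t))"
        by (intro continuous_intros)
      ultimately show ?thesis
        by (intro continuous_on_mult)
    qed
    fix t assume t: "t \<in> {0<..<2 * pi} - {t \<in> {0..2 * pi}. sin (real k * t) = 0}"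
    let ?s = "sin (real k * t)" and ?c = "cos (real k * t)"
    have cis: "((\<lambda>t. cis (?N * t)) has_vector_derivative (of_real ?N * (\<i> * cis (?N * t)))) (at t)"
      unfolding has_vector_derivative_def by (auto intro!: derivative_eq_intros simp: scaleR_conv_of_real)
    have "((\<lambda>t. sin (real k * t)) has_real_derivative real k * ?c) (at t)"
      by (auto intro!: derivative_eq_intros)
    moreover have "?s \<noteq> 0" using t by auto
    ultimately have "((\<lambda>t. ?\<sigma> (sin (real k * t))) has_real_derivative
        ((2 * l + 1) * \<bar>?s\<bar> powr (2 * l)) * (real k * ?c)) (at t)"
      by (intro DERIV_chain2[OF DERIV_mult_abs_powr])
    then have "((\<lambda>t. ?\<sigma> (sin (real k * t))) has_real_derivative
        ((2 * l + 1) * weight_sq k l t) * (real k * ?c)) (at t)"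
      by (simp add: weight_sq_def)
    from has_vector_derivative_mult[OF cis has_vector_derivative_of_real[OF this]]
    have "(?H has_vector_derivative (cis (?N * t) * of_real ((2 * l + 1) * weight_sq k l t * (real k * ?c))
       + of_real ?N * (\<i> * cis (?N * t)) * of_real (?\<sigma> ?s))) (at t)" .
    also have "?\<sigma> ?s = weight_sq k l t * ?s"
      by (simp add: weight_sq_def)
    also have "cis (?N * t) * of_real ((2 * l + 1) * weight_sq k l t * (real k * ?c))
       + of_real ?N * (\<i> * cis (?N * t)) * of_real (weight_sq k l t * ?s) = ?H' t"
    proof -
      let ?E = "cis (real k * t)" and ?F = "cis (- (real k * t))"
      have E: "?E = of_real ?c + \<i> * of_real ?s" and F: "?F = of_real ?c - \<i> * of_real ?s"
        by (rule complex_eqI; simp)+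
      have "cis (of_int (2 * int k * (m + 1)) * t) = cis (?N * t) * ?E"
           "cis (of_int (2 * int k * m) * t) = cis (?N * t) * ?F"
        unfolding cis_mult by (simp_all add: algebra_simps)
      moreover have alg: "C * ((2 * L + 1) * w * (K * c)) + (2 * M + 1) * K * (I * C) * (w * s) =
        K * ((M + 1 + L) * (w * (C * (c + I * s))) - (M - L) * (w * (C * (c - I * s))))" for C L w K c M s I :: complex
        by (simp add: algebra_simps)
      ultimately show ?thesis
        unfolding E F by (simp only: scaleR_conv_of_real of_real_mult of_real_add of_real_diff of_real_1 of_real_numeral)
    qed
    finally show "(?H has_vector_derivative ?H' t) (at t)" .
  qed simp
  moreover have "?H (2 * pi) - ?H 0 = 0"
  proof -
    have "sin (real k * (2 * pi)) = 0"
      using sin_zero_iff_int2[of "real k * (2 * pi)"] by (auto intro!: exI[of _ "2 * int k"])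
    then show ?thesis by simp
  qed
  ultimately have "(?H' has_integral 0) {0..2 * pi}" by simp
  moreover have "(?H' has_integral (of_real (real k) * (of_real (of_int m + 1 + l) * weight_fourier k l (2 * int k * (m + 1))
        - of_real (of_int m - l) * weight_fourier k l (2 * int k * m)))) {0..2 * pi}"
    by (intro has_integral_mult_right has_integral_diff weight_fourier_has_integral assms)
  ultimately have "of_real (real k) * (of_real (of_int m + 1 + l) * weight_fourier k l (2 * int k * (m + 1))
        - of_real (of_int m - l) * weight_fourier k l (2 * int k * m)) = 0"
    using has_integral_unique by blast
  then show ?thesis
    using assms(1) by simp
qed

text \<open>Integrals and moments obey the same recurrence, which is followed from 0 in both
  directions. It is always solved for the index farther from 0, whose factor j + 1 + l is positive,
  whereas j - l may vanish.\<close>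

lemma weight_fourier_eq_moment:
  assumes "k > 0" "l \<ge> 0"
  shows "weight_fourier k l (2 * int k * m) = of_real (moment l m) * weight_fourier k l 0"
proof -
  have step: "W' = of_real (moment l (int (Suc j))) * w"
    if W: "of_real (real j + 1 + l) * W' = of_real (real j - l) * (of_real (moment l (int j)) * w)" for W' w :: complex and j
  proof -
    have "of_real (real j + 1 + l) * W' = complex_of_real ((real j - l) * moment l (int j)) * w"
      unfolding W by (simp only: of_real_mult mult.assoc)
    also have "\<dots> = of_real (real j + 1 + l) * (of_real (moment l (int (Suc j))) * w)"
      unfolding moment_Suc[OF assms(2), symmetric] by (simp only: of_real_mult mult.assoc)
    finally show ?thesis
      using assms(2) by (simp only: mult_cancel_left of_real_eq_0_iff) linarith
  qed
  have pos: "weight_fourier k l (2 * int k * int j) = of_real (moment l (int j)) * weight_fourier k l 0" for j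
  proof (induction j)
    case (Suc j)
    show ?case
      using weight_fourier_recurrence[OF assms, of "int j"] unfolding Suc of_int_of_nat_eq
      by (intro step) (simp only: of_nat_Suc add.commute)
  qed simp
  have neg: "weight_fourier k l (2 * int k * (- int j)) = of_real (moment l (int j)) * weight_fourier k l 0" for j
  proof (induction j)
    case (Suc j)
    have m: "- int (Suc j) + 1 = - int j" by simp
    have "of_real (l - real j) * weight_fourier k l (2 * int k * (- int j)) =
        of_real (- (real j + 1 + l)) * weight_fourier k l (2 * int k * (- int (Suc j)))"
      using weight_fourier_recurrence[OF assms, of "- int (Suc j)"] unfolding m by (simp add: algebra_simps)
    then show ?case
      unfolding Suc by (intro step) (simp add: algebra_simps)
  qed simp
  show ?thesis
    using pos[of "nat m"] neg[of "nat (- m)"] by (cases "m \<ge> 0") auto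
qed

lemma weight_fourier_0: 
  assumes "k > 0" "l \<ge> 0"
  shows "weight_fourier k l 0 = of_real (integral {0..2 * pi} (weight_sq k l))"
proof -
  have "weight_sq k l integrable_on {0..2 * pi}"
    using weight_sq_integrable[OF assms, of 0 "2 * pi" "\<lambda>_. 1::real"] by simp
  then have "((\<lambda>t. complex_of_real (weight_sq k l t)) has_integral of_real (integral {0..2 * pi} (weight_sq k l))) {0..2 * pi}"
    by (intro has_integral_of_real integrable_integral)
  then show ?thesis
    by (simp add: weight_fourier_def scaleR_conv_of_real integral_unique)
qed

lemma integral_weight_sq_pos:
  assumes "k > 0" "l \<ge> 0"
  shows "integral {0..2 * pi} (weight_sq k l) > 0"
proof (cases "l = 0")
  case True
  have "integral {0..2 * pi} (weight_sq k l) = integral {0..2 * pi} (\<lambda>_. 1)"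
  proof (rule integral_spike)
    show "negligible {t \<in> {0..2 * pi}. sin (real k * t) = 0}"
      by (intro negligible_finite finite_zeros_sin assms(1))
  qed (simp add: weight_sq_def True)
  then show ?thesis by simp
next
  case False
  \<comment> \<open>A point where \<open>sin (k t)\<close> is 1, so that the weight cannot vanish
    identically.\<close>
  let ?t = "pi / (2 * real k)"
  have int: "weight_sq k l integrable_on {0..2 * pi}"
    using weight_sq_integrable[OF assms, of 0 "2 * pi" "\<lambda>_. 1::real"] by simp
  have "integral {0..2 * pi} (weight_sq k l) \<ge> 0"
    by (intro integral_nonneg int) (simp add: weight_sq_def)
  moreover have "integral {0..2 * pi} (weight_sq k l) \<noteq> 0"
  proof
    assume 0: "integral {0..2 * pi} (weight_sq k l) = 0"
    have "continuous_on {0..2 * pi} (weight_sq k l)"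
      using False assms by (intro continuous_on_weight_sq) simp
    from integral_eq_0_iff[OF this, THEN iffD1, OF _ _ 0] have "\<forall>t\<in>{0..2 * pi}. weight_sq k l t = 0"
      by (simp add: weight_sq_def)
    moreover have "?t \<le> pi / 1"
      using assms by (intro divide_left_mono) auto
    then have "?t \<in> {0..2 * pi}" by (auto intro: order_trans)
    ultimately have "weight_sq k l ?t = 0" by blast
    then show False
      using assms by (simp add: weight_sq_def)
  qed
  ultimately show ?thesis by simp
qed

section \<open>Inner products and the reproducing property\<close>

lemma dunkl_poly_cis:
  "dunkl_poly k l n (cis t) =
    (\<Sum>b\<le>n div k. szego_coeff l (n div k) b *\<^sub>R cis (of_int (int n - 2 * int k * int b) * t))"
proof -
  have "cis t ^ (n - k * b) * cnj (cis t) ^ (k * b) = cis (of_int (int n - 2 * int k * int b) * t)"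
    if "b \<le> n div k" for b
    using mult_le_of_le_div[OF that]
    by (simp add: cis_cnj Complex.DeMoivre cis_mult of_nat_diff algebra_simps)
  then show ?thesis
    unfolding dunkl_poly_def by (intro sum.cong refl) simp
qed

text \<open>\<Phi>_q is paired with itself and with its reversal. Orthogonality leaves one term: the
  pairing with \<zeta>^q, times the leading coefficient of \<Phi>_q in the first case and its
  constant coefficient in the second.\<close>

lemma szego_moment_double_sum:
  assumes "l \<ge> 0"
  shows "(\<Sum>b\<le>q. \<Sum>c\<le>q. szego_coeff l q b * szego_coeff l q c * moment l (int c - int b)) =
      negbin (l + 1) q * szego_moment l q (int q)"
    and "(\<Sum>b\<le>q. \<Sum>c\<le>q. szego_coeff l q b * szego_coeff l q c * moment l (int q - int b - int c)) =
      negbin l q * szego_moment l q (int q)"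
proof -
  have "(\<Sum>b\<le>q. \<Sum>c\<le>q. szego_coeff l q b * szego_coeff l q c * moment l (int c - int b)) =
      (\<Sum>c\<le>q. szego_coeff l q c * szego_moment l q (int q - int c))"
    unfolding szego_moment_def sum_distrib_left
    by (subst sum.swap) (intro sum.cong refl, simp add: of_nat_diff mult_ac)
  also have "\<dots> = (\<Sum>c\<in>{0}. szego_coeff l q c * szego_moment l q (int q - int c))"
    by (intro sum.mono_neutral_right) (auto simp: szego_moment_orthogonal[OF assms])
  finally show "(\<Sum>b\<le>q. \<Sum>c\<le>q. szego_coeff l q b * szego_coeff l q c * moment l (int c - int b)) =
      negbin (l + 1) q * szego_moment l q (int q)"
    by (simp add: szego_coeff_def)
  have "(\<Sum>b\<le>q. \<Sum>c\<le>q. szego_coeff l q b * szego_coeff l q c * moment l (int q - int b - int c)) =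
      (\<Sum>c\<le>q. szego_coeff l q c * szego_moment l q (int c))"
    unfolding szego_moment_def sum_distrib_left
    by (subst sum.swap) (intro sum.cong refl, simp add: of_nat_diff mult_ac)
  also have "\<dots> = (\<Sum>c\<in>{q}. szego_coeff l q c * szego_moment l q (int c))"
    by (intro sum.mono_neutral_right) (auto simp: szego_moment_orthogonal[OF assms])
  finally show "(\<Sum>b\<le>q. \<Sum>c\<le>q. szego_coeff l q b * szego_coeff l q c * moment l (int q - int b - int c)) =
      negbin l q * szego_moment l q (int q)"
    by (simp add: szego_coeff_def)
qed

lemma weight_double_sum_has_integral:
  assumes "k > 0" "l \<ge> 0" and "finite I" "finite J" and f: "\<And>t. f t = (\<Sum>b\<in>I. \<Sum>c\<in>J. a b c *\<^sub>R cis (of_int (m b c) * t))"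
  shows "((\<lambda>t. weight_sq k l t *\<^sub>R f t) has_integral
    (\<Sum>b\<in>I. \<Sum>c\<in>J. a b c *\<^sub>R weight_fourier k l (m b c))) {0..2 * pi}"
proof -
  have "((\<lambda>t. \<Sum>b\<in>I. \<Sum>c\<in>J. a b c *\<^sub>R (weight_sq k l t *\<^sub>R cis (of_int (m b c) * t))) has_integral
    (\<Sum>b\<in>I. \<Sum>c\<in>J. a b c *\<^sub>R weight_fourier k l (m b c))) {0..2 * pi}"
    by (intro has_integral_sum has_integral_cmul weight_fourier_has_integral assms)
  moreover have "weight_sq k l t *\<^sub>R f t = (\<Sum>b\<in>I. \<Sum>c\<in>J. a b c *\<^sub>R (weight_sq k l t *\<^sub>R cis (of_int (m b c) * t)))" for t
    unfolding f scaleR_sum_right by (simp only: scaleR_left_commute)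
  ultimately show ?thesis by (simp only:)
qed

lemma dunkl_poly_norm_has_integral:
  assumes "k > 0" "l \<ge> 0"
  shows "((\<lambda>t. weight_sq k l t *\<^sub>R (dunkl_poly k l n (cis t) * cnj (dunkl_poly k l n (cis t)))) has_integral
    of_real (negbin (l + 1) (n div k) * szego_moment l (n div k) (int (n div k))) * weight_fourier k l 0) {0..2 * pi}"
proof -
  let ?q = "n div k"
  let ?s = "szego_coeff l ?q"
  have "dunkl_poly k l n (cis t) * cnj (dunkl_poly k l n (cis t)) =
      (\<Sum>b\<le>?q. \<Sum>c\<le>?q. (?s b * ?s c) *\<^sub>R cis (of_int (2 * int k * (int c - int b)) * t))" for t
  proof -
    have "cis (of_int (int n - 2 * int k * int b) * t) * cnj (cis (of_int (int n - 2 * int k * int c) * t)) =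
        cis (of_int (2 * int k * (int c - int b)) * t)" for b c
      by (simp add: cis_cnj cis_mult algebra_simps)
    moreover have "(a *\<^sub>R v) * (b *\<^sub>R w) = (a * b) *\<^sub>R (v * w)" for a b and v w :: complex
      by simp
    ultimately show ?thesis
      unfolding dunkl_poly_cis cnj_sum sum_product by (simp only: complex_cnj_scaleR)
  qed
  from weight_double_sum_has_integral[OF assms finite_atMost finite_atMost this]
  have "((\<lambda>t. weight_sq k l t *\<^sub>R (dunkl_poly k l n (cis t) * cnj (dunkl_poly k l n (cis t)))) has_integral
    (\<Sum>b\<le>?q. \<Sum>c\<le>?q. (?s b * ?s c) *\<^sub>R weight_fourier k l (2 * int k * (int c - int b)))) {0..2 * pi}" .
  also have "(\<Sum>b\<le>?q. \<Sum>c\<le>?q. (?s b * ?s c) *\<^sub>R weight_fourier k l (2 * int k * (int c - int b))) =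
     of_real (\<Sum>b\<le>?q. \<Sum>c\<le>?q. ?s b * ?s c * moment l (int c - int b)) * weight_fourier k l 0"
    unfolding weight_fourier_eq_moment[OF assms]
    by (simp only: of_real_sum of_real_mult sum_distrib_right scaleR_conv_of_real mult.assoc)
  finally show ?thesis
    unfolding szego_moment_double_sum[OF assms(2)] .
qed

text \<open>The frequencies are 2 n modulo 2 k. If k does not divide n, every term vanishes by
  \<open>weight_fourier_eq_0\<close>; otherwise \<phi>_n^2 pairs \<Phi>_q with its reversal.\<close>

lemma dunkl_poly_square_has_integral:
  assumes "k > 0" "l \<ge> 0"
  shows "((\<lambda>t. weight_sq k l t *\<^sub>R (dunkl_poly k l n (cis t) * dunkl_poly k l n (cis t))) has_integral
    of_real (if k dvd n then negbin l (n div k) * szego_moment l (n div k) (int (n div k)) else 0) *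
    weight_fourier k l 0) {0..2 * pi}"
proof -
  let ?q = "n div k"
  let ?s = "szego_coeff l ?q"
  have "dunkl_poly k l n (cis t) * dunkl_poly k l n (cis t) =
      (\<Sum>b\<le>?q. \<Sum>c\<le>?q. (?s b * ?s c) *\<^sub>R cis (of_int (2 * (int n - int k * (int b + int c))) * t))" for t
  proof -
    have "cis (of_int (int n - 2 * int k * int b) * t) * cis (of_int (int n - 2 * int k * int c) * t) =
        cis (of_int (2 * (int n - int k * (int b + int c))) * t)" for b c
      by (simp add: cis_mult algebra_simps)
    moreover have "(a *\<^sub>R v) * (b *\<^sub>R w) = (a * b) *\<^sub>R (v * w)" for a b and v w :: complex
      by simp
    ultimately show ?thesis
      unfolding dunkl_poly_cis sum_product by (simp only:)
  qed
  from weight_double_sum_has_integral[OF assms finite_atMost finite_atMost this]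
  have *: "((\<lambda>t. weight_sq k l t *\<^sub>R (dunkl_poly k l n (cis t) * dunkl_poly k l n (cis t))) has_integral
    (\<Sum>b\<le>?q. \<Sum>c\<le>?q. (?s b * ?s c) *\<^sub>R weight_fourier k l (2 * (int n - int k * (int b + int c))))) {0..2 * pi}" .
  show ?thesis
  proof (cases "k dvd n")
    case True
    then have "int n = int k * int ?q"
      by (metis dvd_mult_div_cancel of_nat_mult)
    then have m: "2 * (int n - int k * (int b + int c)) = 2 * int k * (int ?q - int b - int c)" for b c
      by (simp only: right_diff_distrib distrib_left mult_ac)
    have "(\<Sum>b\<le>?q. \<Sum>c\<le>?q. (?s b * ?s c) *\<^sub>R weight_fourier k l (2 * (int n - int k * (int b + int c)))) =
       of_real (\<Sum>b\<le>?q. \<Sum>c\<le>?q. ?s b * ?s c * moment l (int ?q - int b - int c)) * weight_fourier k l 0"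
      unfolding m weight_fourier_eq_moment[OF assms]
      by (simp only: of_real_sum of_real_mult sum_distrib_right scaleR_conv_of_real mult.assoc)
    with * True show ?thesis
      unfolding szego_moment_double_sum[OF assms(2)] by (simp only: if_True)
  next
    case False
    have "\<not> int k dvd int n - int k * c" for c
    proof
      assume "int k dvd int n - int k * c"
      then have "int k dvd int n - int k * c + int k * c"
        by (intro dvd_add) simp_all
      with False show False by simp
    qed
    then have "weight_fourier k l (2 * (int n - int k * (int b + int c))) = 0" for b c
      by (rule weight_fourier_eq_0[OF assms])
    with * False show ?thesis by simp
  qed
qed

text \<open>From 2 Re a Re b = Re (a \<open>cnj b\<close>) + Re (a b) with a = d \<phi>_n and b = e
  \<phi>_n.\<close>

lemma h_inner_dunkl_re:
  assumes "k > 0" "l \<ge> 0"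
  shows "h_inner k l (dunkl_re k l n d) (dunkl_re k l n e) = szego_moment l (n div k) (int (n div k)) / 2 *
    (negbin (l + 1) (n div k) * Re (d * cnj e) + (if k dvd n then negbin l (n div k) * Re (d * e) else 0))"
proof -
  let ?q = "n div k" and ?P = "\<lambda>t. dunkl_poly k l n (cis t)"
  let ?W = "integral {0..2 * pi} (weight_sq k l)"
  define M where "M = negbin (l + 1) ?q * szego_moment l ?q (int ?q)"
  define M' where "M' = (if k dvd n then negbin l ?q * szego_moment l ?q (int ?q) else 0)"
  have int: "((\<lambda>t. (d * cnj e / 2) * (weight_sq k l t *\<^sub>R (?P t * cnj (?P t))) + (d * e / 2) * (weight_sq k l t *\<^sub>R (?P t * ?P t)))
      has_integral ((d * cnj e / 2) * (of_real M * weight_fourier k l 0) + (d * e / 2) * (of_real M' * weight_fourier k l 0))) {0..2 * pi}"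
    unfolding M_def M'_def
    by (intro has_integral_add has_integral_mult_right dunkl_poly_norm_has_integral dunkl_poly_square_has_integral assms)
  have "Re ((d * cnj e / 2) * (w *\<^sub>R (P * cnj P)) + (d * e / 2) * (w *\<^sub>R (P * P))) = Re (d * P) * Re (e * P) * w" for w P
    by (simp add: field_simps)
  then have "Re ((d * cnj e / 2) * (weight_sq k l t *\<^sub>R (?P t * cnj (?P t))) + (d * e / 2) * (weight_sq k l t *\<^sub>R (?P t * ?P t))) =
      dunkl_re k l n d (circle_point t) * dunkl_re k l n e (circle_point t) * weight_sq k l t" for t
    unfolding dunkl_re_def cplx_circle_point .
  with has_integral_Re[OF int]
  have "integral {0..2 * pi} (\<lambda>t. dunkl_re k l n d (circle_point t) * dunkl_re k l n e (circle_point t) * weight_sq k l t) =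
      Re ((d * cnj e / 2) * (of_real M * weight_fourier k l 0) + (d * e / 2) * (of_real M' * weight_fourier k l 0))"
    by (simp only: integral_unique)
  also have "\<dots> = (M * Re (d * cnj e) + M' * Re (d * e)) / 2 * ?W"
    unfolding weight_fourier_0[OF assms] by (simp add: field_simps)
  finally have "h_inner k l (dunkl_re k l n d) (dunkl_re k l n e) = (M * Re (d * cnj e) + M' * Re (d * e)) / 2"
    unfolding h_inner_def weight_const_def using integral_weight_sq_pos[OF assms] by simp
  moreover have "(M * a + M' * b) / 2 = szego_moment l ?q (int ?q) / 2 *
      (negbin (l + 1) ?q * a + (if k dvd n then negbin l ?q * b else 0))" for a b
    by (simp add: M_def M'_def field_simps)
  ultimately show ?thesis by (simp only:)
qed

text \<open>The real part of d^2 may be negative, but it is at most |d|^2 in absolute value, and its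
  factor \<open>negbin l q\<close> is strictly below \<open>negbin (l + 1) q\<close> once q \<ge>
  1.\<close>

lemma h_inner_dunkl_re_pos:
  assumes "k > 0" "l \<ge> 0" "n \<ge> 1" "d \<noteq> 0"
  shows "h_inner k l (dunkl_re k l n d) (dunkl_re k l n d) > 0"
proof -
  let ?q = "n div k"
  have d: "Re (d * cnj d) = (norm d)\<^sup>2"
    unfolding complex_norm_square[symmetric] by simp
  have S: "negbin (l + 1) ?q > 0" using assms by (simp add: negbin_pos)
  have "negbin (l + 1) ?q * Re (d * cnj d) + (if k dvd n then negbin l ?q * Re (d * d) else 0) > 0"
  proof (cases "k dvd n")
    case True
    then have "?q \<noteq> 0"
      using assms by (metis dvd_mult_div_cancel mult_0_right not_one_le_zero)
    then obtain q' where q': "?q = Suc q'" using not0_implies_Suc by blast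
    have "negbin l ?q < negbin (l + 1) ?q"
      unfolding q' negbin_plus1_Suc using negbin_pos[of "l + 1" q'] assms by simp
    moreover have "\<bar>Re (d * d)\<bar> \<le> (norm d)\<^sup>2"
      using abs_Re_le_cmod[of "d * d"] by (simp add: norm_mult power2_eq_square)
    then have "negbin l ?q * (- Re (d * d)) \<le> negbin l ?q * (norm d)\<^sup>2"
      using assms by (intro mult_left_mono negbin_nonneg) auto
    moreover have "(norm d)\<^sup>2 > 0" using assms(4) by simp
    then have "negbin l ?q * (norm d)\<^sup>2 < negbin (l + 1) ?q * (norm d)\<^sup>2"
      using \<open>negbin l ?q < negbin (l + 1) ?q\<close> by (intro mult_strict_right_mono)
    ultimately show ?thesis
      unfolding d if_P[OF True] by linarith
  next
    case False
    then show ?thesis unfolding d using S assms(4) by simp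
  qed
  then show ?thesis
    unfolding h_inner_dunkl_re[OF assms(1,2)] using szego_moment_top_pos[OF assms(2), of ?q] by simp
qed

lemma dunkl_re_linear: "dunkl_re k l n (of_real a * d + of_real b * e) x = a * dunkl_re k l n d x + b * dunkl_re k l n e x"
  by (simp add: dunkl_re_def algebra_simps)

lemma dunkl_re_eq_0_imp:
  assumes "k > 0" "l \<ge> 0" "n \<ge> 1" and "\<And>x. dunkl_re k l n d x = 0"
  shows "d = 0"
proof (rule ccontr)
  assume "d \<noteq> 0"
  from h_inner_dunkl_re_pos[OF assms(1-3) this] show False
    by (simp add: h_inner_def assms(4))
qed

section \<open>Points whose k-th power is real\<close>

lemma pow_n_minus_cnj:
  fixes c :: complex
  assumes "cnj (c ^ k) = c ^ k" and "k * b \<le> n"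
  shows "c ^ (n - k * b) * cnj c ^ (k * b) = c ^ n"
proof -
  have "cnj c ^ (k * b) = c ^ (k * b)"
    using assms(1) by (simp add: power_mult)
  then show ?thesis
    using assms(2) by (simp flip: power_add)
qed

text \<open>As \<open>c ^ k\<close> is real, all monomials of \<phi>_n acquire the same factor
  \<open>c ^ n\<close>. For a general point the factors would depend on b.\<close>

lemma dunkl_poly_rotate:
  assumes "cnj (c ^ k) = c ^ k"
  shows "dunkl_poly k l n (z * c) = c ^ n * dunkl_poly k l n z"
proof -
  have "(z * c) ^ (n - k * b) * cnj (z * c) ^ (k * b) = c ^ n * (z ^ (n - k * b) * cnj z ^ (k * b))"
    if "b \<le> n div k" for b
    unfolding pow_n_minus_cnj[OF assms mult_le_of_le_div[OF that], symmetric]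
    by (simp add: power_mult_distrib mult_ac)
  then show ?thesis
    unfolding dunkl_poly_def sum_distrib_left by (intro sum.cong refl) simp
qed

text \<open>The coefficients of l \<phi>_n are those of \<open>weight_poly\<close> times l + q - b.
  The real parts of the monomials are symmetric under reversing b, so averaging replaces this factor
  by (2 l + q) / 2.\<close>

lemma weight_poly_eq_dunkl_poly:
  assumes "k > 0" "k dvd n"
  shows "(2 * l + real (n div k)) * Re (weight_poly k l n z) = 2 * l * Re (dunkl_poly k l n z)"
proof -
  let ?q = "n div k"
  have n: "n = k * ?q" using assms(2) by simp
  define R where "R b = Re (z ^ (n - k * b) * cnj z ^ (k * b))" for b
  have R: "R (?q - b) = R b" if "b \<le> ?q" for b
  proof -
    have "k * (?q - b) = n - k * b" "n - (n - k * b) = k * b"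
      using n mult_le_of_le_div[OF that] by (auto simp: diff_mult_distrib2)
    then have "R (?q - b) = Re (cnj (z ^ (n - k * b) * cnj z ^ (k * b)))"
      unfolding R_def by (simp only: complex_cnj_mult complex_cnj_power complex_cnj_cnj mult.commute)
    moreover have "Re (cnj w) = Re w" for w by simp
    ultimately show ?thesis by (simp only: R_def)
  qed
  let ?a = "\<lambda>b. negbin l b * negbin l (?q - b)"
  have P: "l * Re (dunkl_poly k l n z) = (\<Sum>b\<le>?q. (l + real (?q - b)) * (?a b * R b))"
  proof -
    have "l * (szego_coeff l ?q b * R b) = (l + real (?q - b)) * (?a b * R b)" for b
      using mult_negbin_plus1[of l "?q - b"] unfolding szego_coeff_def
      by (metis mult.assoc mult.left_commute)
    then show ?thesis
      unfolding dunkl_poly_def Re_sum scaleR_complex.sel sum_distrib_left R_def[symmetric] by (simp only:)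
  qed
  also have "\<dots> = (\<Sum>b\<le>?q. (l + real (?q - (?q - b))) * (?a (?q - b) * R (?q - b)))"
    by (rule sum.nat_diff_reindex[symmetric, of "\<lambda>b. (l + real (?q - b)) * (?a b * R b)" "Suc ?q",
          unfolded lessThan_Suc_atMost diff_Suc_Suc])
  also have "\<dots> = (\<Sum>b\<le>?q. (l + real b) * (?a b * R b))"
    by (intro sum.cong refl) (simp add: R mult_ac)
  finally have "2 * l * Re (dunkl_poly k l n z) =
      (\<Sum>b\<le>?q. (l + real (?q - b)) * (?a b * R b) + (l + real b) * (?a b * R b))"
    using P by (simp add: sum.distrib)
  also have "\<dots> = (\<Sum>b\<le>?q. (2 * l + real ?q) * (?a b * R b))"
    by (intro sum.cong refl) (simp add: of_nat_diff algebra_simps)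
  also have "\<dots> = (2 * l + real ?q) * Re (weight_poly k l n z)"
    using assms(2) by (simp add: weight_poly_def R_def sum_distrib_left)
  finally show ?thesis ..
qed

text \<open>
  For \<open>k dvd n\<close>, \<open>weight_poly\<close> is a multiple of the real part of \<open>dunkl_poly\<close>, so that it can be absorbed into the factor.
\<close>

definition poisson_factor :: "nat \<Rightarrow> real \<Rightarrow> nat \<Rightarrow> real" where
  "poisson_factor k l n = (if k dvd n then 2 * (l + real (n div k)) / (2 * l + real (n div k)) else 2)"

lemma poisson_factor_dunkl_poly:
  assumes "k > 0" "l \<ge> 0" "n \<ge> 1"
  shows "Re (2 * dunkl_poly k l n z - weight_poly k l n z) = poisson_factor k l n * Re (dunkl_poly k l n z)"
proof (cases "k dvd n")
  case True
  let ?q = "n div k"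
  have "?q \<noteq> 0"
    using assms True by (metis dvd_mult_div_cancel mult_0_right not_one_le_zero)
  then have q: "2 * l + real ?q > 0" using assms(2) by simp
  have "(2 * l + real ?q) * Re (2 * dunkl_poly k l n z - weight_poly k l n z) =
      2 * (l + real ?q) * Re (dunkl_poly k l n z)"
    using weight_poly_eq_dunkl_poly[OF assms(1) True, of l z] by (simp add: algebra_simps)
  with q show ?thesis
    unfolding poisson_factor_def if_P[OF True] by (simp add: field_simps)
qed (simp add: weight_poly_def poisson_factor_def)

lemma cis_pi_fraction_power:
  assumes "k > 0"
  shows "cis (real p * pi / real k) ^ k = (- 1) ^ p"
proof -
  have "cis (real p * pi / real k) ^ k = cis (real p * pi)"
    using assms by (simp add: Complex.DeMoivre)
  also have "\<dots> = cis pi ^ p"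
    by (simp only: Complex.DeMoivre)
  finally show ?thesis by simp
qed

context
  fixes k p :: nat and l :: real and u :: complex
  assumes k: "k > 0" and l: "l \<ge> 0"
  defines "u \<equiv> cis (real p * pi / real k)"
begin

lemmas u_pow_k = cis_pi_fraction_power[OF k, of p, folded u_def]

text \<open>Rotation reduces to the value at 1, the sum of the coefficients, and
  \<open>szego_moment_top\<close> identifies this with the squared norm.\<close>

lemma dunkl_poly_u: "dunkl_poly k l n u = u ^ n * of_real (szego_moment l (n div k) (int (n div k)) * negbin (l + 1) (n div k))"
proof -
  have "cnj (u ^ k) = u ^ k" by (simp add: u_pow_k)
  from dunkl_poly_rotate[OF this, of l n 1] show ?thesis
    by (simp only: mult_1 szego_moment_top[OF l])
      (simp add: dunkl_poly_def scaleR_conv_of_real)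
qed

text \<open>For \<open>k dvd n\<close>, \<open>u ^ n\<close> is real, so both terms of
  \<open>h_inner_dunkl_re\<close> contain Re (d \<open>u ^ n\<close>). \<open>poisson_factor\<close>
  is the constant that turns \<open>negbin (l + 1) q + negbin l q\<close> into
  \<open>2 * negbin (l + 1) q\<close>.\<close>

lemma dunkl_re_reproducing:
  assumes "n \<ge> 1" and y: "cplx y = u"
  shows "h_inner k l (dunkl_re k l n d) (dunkl_re k l n (of_real (poisson_factor k l n) * cnj u ^ n)) = dunkl_re k l n d y"
proof -
  let ?q = "n div k" and ?c = "poisson_factor k l n"
  have R: "Re (d * cnj (of_real ?c * cnj u ^ n)) = ?c * Re (d * u ^ n)"
    by (simp add: algebra_simps)
  have "?c * (negbin (l + 1) ?q * Re (d * u ^ n) + (if k dvd n then negbin l ?q * Re (d * u ^ n) else 0)) =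
     2 * negbin (l + 1) ?q * Re (d * u ^ n)"
  proof (cases "k dvd n")
    case True
    have "?q \<noteq> 0"
      using assms True by (metis dvd_mult_div_cancel mult_0_right not_one_le_zero)
    then have q: "2 * l + real ?q > 0" using l by simp
    have "(l + real ?q) * (negbin (l + 1) ?q + negbin l ?q) = (2 * l + real ?q) * negbin (l + 1) ?q"
      using mult_negbin_plus1[of l ?q] by (simp add: algebra_simps)
    then have "?c * (negbin (l + 1) ?q + negbin l ?q) = 2 * negbin (l + 1) ?q"
      using q unfolding poisson_factor_def if_P[OF True] by (simp add: field_simps)
    then show ?thesis
      using True by (simp only: if_True distrib_right[symmetric] mult.assoc[symmetric])
  qed (simp add: poisson_factor_def)
  moreover have "Re (d * (of_real ?c * cnj u ^ n)) = ?c * Re (d * u ^ n)" if "k dvd n"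
  proof -
    have "cnj u ^ k = u ^ k"
      using u_pow_k by (metis complex_cnj_minus complex_cnj_one complex_cnj_power)
    then have "cnj u ^ n = u ^ n"
      using that by (metis dvd_mult_div_cancel power_mult)
    then show ?thesis by (simp add: algebra_simps)
  qed
  then have "(if k dvd n then negbin l ?q * Re (d * (of_real ?c * cnj u ^ n)) else 0) =
      ?c * (if k dvd n then negbin l ?q * Re (d * u ^ n) else 0)"
    by (cases "k dvd n") (simp_all only: if_True if_False mult.left_commute mult_zero_right)
  ultimately have "negbin (l + 1) ?q * (?c * Re (d * u ^ n)) +
      (if k dvd n then negbin l ?q * Re (d * (of_real ?c * cnj u ^ n)) else 0) = 2 * negbin (l + 1) ?q * Re (d * u ^ n)"
    by (simp only: distrib_left mult.left_commute)
  then have "h_inner k l (dunkl_re k l n d) (dunkl_re k l n (of_real ?c * cnj u ^ n)) =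
      szego_moment l ?q (int ?q) * negbin (l + 1) ?q * Re (d * u ^ n)"
    unfolding h_inner_dunkl_re[OF k l] R by (simp add: mult.left_commute)
  also have "\<dots> = dunkl_re k l n d y"
    unfolding dunkl_re_def y dunkl_poly_u by (simp add: algebra_simps)
  finally show ?thesis .
qed

text \<open>Express the functions for d = 1 and d = i in the two basis elements and invert by
  Cramer's rule.\<close>

lemma orthogonal_basis_dunkl_re:
  assumes "n \<ge> 1" and B: "orthogonal_basis k l n B"
  obtains d\<^sub>1 d\<^sub>2 where "B 1 = dunkl_re k l n d\<^sub>1" "B 2 = dunkl_re k l n d\<^sub>2" "d\<^sub>1 \<noteq> 0" "d\<^sub>2 \<noteq> 0"
proof -
  have idx: "basis_index n = {1, 2}" using assms(1) by (simp add: basis_index_def)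
  have span: "\<exists>a b. \<forall>x. dunkl_re k l n d x = a * B 1 x + b * B 2 x" for d
  proof -
    obtain c where "\<forall>x. dunkl_re k l n d x = (\<Sum>i\<in>{1, 2}. c i * B i x)"
      using B dunkl_re_in_h_harmonics[OF k, of l n d] unfolding orthogonal_basis_def idx by blast
    then show ?thesis by auto
  qed
  obtain a\<^sub>1 b\<^sub>1 where 1: "\<And>x. dunkl_re k l n 1 x = a\<^sub>1 * B 1 x + b\<^sub>1 * B 2 x" using span by blast
  obtain a\<^sub>2 b\<^sub>2 where 2: "\<And>x. dunkl_re k l n \<i> x = a\<^sub>2 * B 1 x + b\<^sub>2 * B 2 x" using span by blast
  let ?D = "a\<^sub>1 * b\<^sub>2 - a\<^sub>2 * b\<^sub>1"
  have comb: "dunkl_re k l n (Complex s t) x = s * dunkl_re k l n 1 x + t * dunkl_re k l n \<i> x" for s t x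
    by (simp add: dunkl_re_def algebra_simps)
  have e1: "dunkl_re k l n (Complex b\<^sub>2 (- b\<^sub>1)) x = ?D * B 1 x" for x
    unfolding comb 1 2 by (simp add: algebra_simps)
  have e2: "dunkl_re k l n (Complex (- a\<^sub>2) a\<^sub>1) x = ?D * B 2 x" for x
    unfolding comb 1 2 by (simp add: algebra_simps)
  \<comment> \<open>With determinant 0, \<open>e1\<close> and \<open>e2\<close> give zero functions,
    so all four coefficients vanish, contradicting the independence supplied by positivity of the
    norm.\<close>
  have "?D \<noteq> 0"
  proof
    assume "?D = 0"
    then have "Complex b\<^sub>2 (- b\<^sub>1) = 0" "Complex (- a\<^sub>2) a\<^sub>1 = 0"
      using dunkl_re_eq_0_imp[OF k l assms(1)] e1 e2 by simp_all
    then have "dunkl_re k l n 1 x = 0" for x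
      unfolding 1 by (simp add: complex_eq_iff)
    from dunkl_re_eq_0_imp[OF k l assms(1) this] show False by simp
  qed
  have scale: "dunkl_re k l n (of_real c * d) x = c * dunkl_re k l n d x" for c d x
    by (simp add: dunkl_re_def algebra_simps)
  have B1: "B 1 = dunkl_re k l n (of_real (1 / ?D) * Complex b\<^sub>2 (- b\<^sub>1))"
    using \<open>?D \<noteq> 0\<close> by (simp only: fun_eq_iff scale e1) simp
  have B2: "B 2 = dunkl_re k l n (of_real (1 / ?D) * Complex (- a\<^sub>2) a\<^sub>1)"
    using \<open>?D \<noteq> 0\<close> by (simp only: fun_eq_iff scale e2) simp
  have nonzero: "\<exists>x. B i x \<noteq> 0" if "i \<in> {1, 2}" for i
  proof (rule ccontr)
    assume "\<not> (\<exists>x. B i x \<noteq> 0)"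
    then have "\<forall>x. (\<Sum>j\<in>{1, 2}. (if j = i then 1 else 0) * B j x) = 0"
      using that by auto
    then have "\<forall>j\<in>{1, 2}. (if j = i then 1 else 0) = (0::real)"
      using B unfolding orthogonal_basis_def idx by (elim conjE allE[where x = "\<lambda>j. if j = i then 1 else 0"]) blast
    then show False using that by auto
  qed
  have "dunkl_re k l n 0 x = 0" for x by (simp add: dunkl_re_def)
  then show ?thesis
    using that[OF B1 B2] nonzero[of 1] nonzero[of 2] B1 B2 by (metis insertCI)
qed

text \<open>Expand the reproducing function as c_1 B_1 + c_2 B_2. Pairing with B_i gives B_i(y) =
  c_i H_i by orthogonality, and these quotients are the coefficients in the kernel.\<close>

lemma kernel_sum_eq:
  assumes "n \<ge> 1" and B: "orthogonal_basis k l n B" and y: "cplx y = u"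
  shows "kernel_sum k l n B x y = dunkl_re k l n (of_real (poisson_factor k l n) * cnj u ^ n) x"
proof -
  let ?e = "of_real (poisson_factor k l n) * cnj u ^ n"
  have idx: "basis_index n = {1, 2}" using assms(1) by (simp add: basis_index_def)
  obtain d\<^sub>1 d\<^sub>2 where d: "B 1 = dunkl_re k l n d\<^sub>1" "B 2 = dunkl_re k l n d\<^sub>2" "d\<^sub>1 \<noteq> 0" "d\<^sub>2 \<noteq> 0"
    using orthogonal_basis_dunkl_re[OF assms(1) B] .
  obtain c where "\<forall>x. dunkl_re k l n ?e x = (\<Sum>i\<in>{1, 2}. c i * B i x)"
    using B dunkl_re_in_h_harmonics[OF k, of l n ?e] unfolding orthogonal_basis_def idx by blast
  then have c: "dunkl_re k l n ?e x = c 1 * B 1 x + c 2 * B 2 x" for x by simp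
  have orth: "h_inner k l (B 1) (B 2) = 0" "h_inner k l (B 2) (B 1) = 0"
    using B unfolding orthogonal_basis_def idx by auto
  have diff: "dunkl_re k l n (f - g) x = dunkl_re k l n f x - dunkl_re k l n g x" for f g x
    by (simp add: dunkl_re_def algebra_simps)
  \<comment> \<open>The equality of functions is transferred to the complex parameters, on which
    \<open>lin\<close> expresses bilinearity.\<close>
  have "dunkl_re k l n (?e - (of_real (c 1) * d\<^sub>1 + of_real (c 2) * d\<^sub>2)) x = 0" for x
    unfolding diff dunkl_re_linear c d by simp
  from dunkl_re_eq_0_imp[OF k l assms(1) this] have e: "?e = of_real (c 1) * d\<^sub>1 + of_real (c 2) * d\<^sub>2"
    unfolding right_minus_eq .
  have lin: "h_inner k l (dunkl_re k l n d) (dunkl_re k l n (of_real s * f + of_real t * g)) =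
      s * h_inner k l (dunkl_re k l n d) (dunkl_re k l n f) + t * h_inner k l (dunkl_re k l n d) (dunkl_re k l n g)" for d f g s t
    unfolding h_inner_dunkl_re[OF k l] by (simp add: algebra_simps)
  have "B 1 y = c 1 * h_inner k l (B 1) (B 1)" "B 2 y = c 2 * h_inner k l (B 2) (B 2)"
    using dunkl_re_reproducing[OF assms(1) y, of d\<^sub>1] dunkl_re_reproducing[OF assms(1) y, of d\<^sub>2] orth
    unfolding e lin d by simp_all
  moreover have "h_inner k l (B 1) (B 1) \<noteq> 0" "h_inner k l (B 2) (B 2) \<noteq> 0"
    using h_inner_dunkl_re_pos[OF k l assms(1)] d by (metis less_irrefl)+
  ultimately show ?thesis
    unfolding kernel_sum_def idx c by simp
qed

lemma kernel_sum_circle: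
  assumes "n \<ge> 1" and "orthogonal_basis k l n B" and "cplx y = u"
  shows "kernel_sum k l n B x y = Re (2 * dunkl_poly k l n (cplx x * cnj u) - weight_poly k l n (cplx x * cnj u))"
proof -
  have "cnj (cnj u ^ k) = cnj u ^ k"
    using u_pow_k by (metis complex_cnj_cnj complex_cnj_minus complex_cnj_one complex_cnj_power)
  from dunkl_poly_rotate[OF this, of l n "cplx x"] show ?thesis
    unfolding kernel_sum_eq[OF assms] poisson_factor_dunkl_poly[OF k l assms(1)] dunkl_re_def
      by (simp add: right_diff_distrib mult.assoc)
qed

end

section \<open>Degree zero and the closed form\<close>

lemma h_inner_const:
  assumes "k > 0" "l \<ge> 0"
  shows "h_inner k l (\<lambda>_. a) (\<lambda>_. b) = a * b"
  using integral_weight_sq_pos[OF assms] by (simp add: h_inner_def weight_const_def)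

text \<open>Ensures that the choice in \<open>reproducing_kernel\<close> yields a basis in degree 0,
  where the family Y is only known to contain the constant 1.\<close>

lemma orthogonal_basis_0:
  assumes "k > 0"
  shows "orthogonal_basis k l 0 (\<lambda>_ _. 1)"
proof -
  have idx: "basis_index 0 = {1}" by (simp add: basis_index_def)
  have "(\<lambda>_. 1) \<in> h_harmonics k l 0"
    using dunkl_re_in_h_harmonics[OF assms, of l 0 1] by (simp add: dunkl_re_def[abs_def])
  moreover have "\<exists>c. \<forall>x. g x = (\<Sum>i\<in>{1::nat}. c i * 1)" if "g \<in> h_harmonics k l 0" for g
  proof -
    have "\<exists>a. \<forall>x. g x = a"
      using that by (auto simp: h_harmonics_def homogeneous_polynomial_def)
    then show ?thesis by auto
  qed
  ultimately show ?thesis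
    unfolding orthogonal_basis_def idx by simp
qed

lemma kernel_sum_0:
  assumes "k > 0" "l \<ge> 0" "orthogonal_basis k l 0 B"
  shows "kernel_sum k l 0 B x y = 1"
proof -
  have idx: "basis_index 0 = {1}" by (simp add: basis_index_def)
  have "B 1 \<in> h_harmonics k l 0"
    using assms(3) by (simp add: orthogonal_basis_def idx)
  then obtain a where a: "B 1 = (\<lambda>_. a)"
    by (auto simp: h_harmonics_def homogeneous_polynomial_def fun_eq_iff)
  have "a \<noteq> 0"
  proof
    assume "a = 0"
    then have "\<forall>x. (\<Sum>i\<in>{1::nat}. 1 * B i x) = 0"
      using a by simp
    then have "(1::real) = 0"
      using assms(3) unfolding orthogonal_basis_def idx by (elim conjE allE[where x = "\<lambda>_. 1"]) blast
    then show False by simp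
  qed
  then show ?thesis
    using a by (simp add: kernel_sum_def idx h_inner_const[OF assms(1,2)])
qed

theorem theorem4p4:
  fixes k p :: nat and l r :: real and x y :: "real ^ 2"
    and Y :: "nat \<Rightarrow> nat \<Rightarrow> real ^ 2 \<Rightarrow> real"
  assumes "2 \<le> k" and "0 \<le> l" and "p \<in> {0..k - 1}"
    and "y = vector [cos (real p * pi / real k), sin (real p * pi / real k)]"
    and "Y 0 1 = (\<lambda>_. 1)"
    and "\<And>n. 1 \<le> n \<Longrightarrow> orthogonal_basis k l n (Y n)"
    and "norm x = 1" and "0 \<le> r" and "r < 1"
  shows "poisson_kernel k l x r y =
      (\<Sum>n. (\<Sum>i\<in>basis_index n. Y n i x * Y n i y / h_inner k l (Y n i) (Y n i)) * r ^ n)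
    \<and> (\<lambda>n. (\<Sum>i\<in>basis_index n. Y n i x * Y n i y / h_inner k l (Y n i) (Y n i)) * r ^ n) sums
      ((1 - r\<^sup>2) /
       ((1 - 2 * r * (cos (real p * pi / real k) * x $ 1 + sin (real p * pi / real k) * x $ 2) + r\<^sup>2) *
        (1 - 2 * (- 1) ^ p * r ^ k * poly (chebyshev_T k) (x $ 1) + r ^ (2 * k)) powr l))"
proof -
  let ?u = "cis (real p * pi / real k)"
  \<comment> \<open>The rotation that takes y to 1, so that \<open>Re z\<close> is the scalar
    product of x and y.\<close>
  define z where "z = cplx x * cnj ?u"
  have k: "k > 0" using assms(1) by simp
  have y: "cplx y = ?u"
    by (rule complex_eqI) (simp_all add: assms(4))
  have nx: "norm (cplx x) = 1"
    using assms(7) by (simp add: norm_eq_1 cmod_def inner_vec_def sum_2 power2_eq_square)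
  have basis: "kernel_sum k l n B x y = Re (2 * dunkl_poly k l n z - weight_poly k l n z)"
    if "orthogonal_basis k l n B" for n B
  proof (cases "n = 0")
    case True
    then show ?thesis
      using kernel_sum_0[OF k assms(2)] that by (simp add: weight_poly_def)
  next
    case False
    then show ?thesis
      using kernel_sum_circle[OF k assms(2) _ that y] by (simp add: z_def)
  qed
  have Y: "(\<Sum>i\<in>basis_index n. Y n i x * Y n i y / h_inner k l (Y n i) (Y n i)) =
      Re (2 * dunkl_poly k l n z - weight_poly k l n z)" for n
  proof (cases "n = 0")
    case True
    have idx: "basis_index 0 = {1}" by (simp add: basis_index_def)
    show ?thesis
      using k assms(5) by (simp add: True idx h_inner_const[OF k assms(2)] weight_poly_def)
  next
    case False
    then show ?thesis
      using basis[OF assms(6)] unfolding kernel_sum_def by simp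
  qed
  have "reproducing_kernel k l n x y = Re (2 * dunkl_poly k l n z - weight_poly k l n z)" for n
  proof -
    have "\<exists>B. orthogonal_basis k l n B"
      using orthogonal_basis_0[OF k] assms(6) by (metis less_one not_le)
    from someI_ex[OF this] show ?thesis
      unfolding reproducing_kernel_def by (rule basis)
  qed
  then have "poisson_kernel k l x r y =
      (\<Sum>n. (\<Sum>i\<in>basis_index n. Y n i x * Y n i y / h_inner k l (Y n i) (Y n i)) * r ^ n)"
    unfolding poisson_kernel_def Y by simp
  moreover have "Re z = cos (real p * pi / real k) * x $ 1 + sin (real p * pi / real k) * x $ 2"
    by (simp add: z_def mult.commute)
  moreover have "Re (z ^ k) = (- 1) ^ p * poly (chebyshev_T k) (x $ 1)"
  proof -
    obtain t where t: "cplx x = cis t"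
      using nx by (metis complex_norm_eq_1_exp_eq cis_conv_exp)
    then have "x $ 1 = cos t" by (metis Re_cplx cis.sel(1))
    \<comment> \<open>The origin of the sign in the second factor of the denominator;
      \<open>Re (cplx x ^ k)\<close> is the Chebyshev value on the circle.\<close>
    have "cnj ?u ^ k = cnj ((- 1) ^ p)"
      unfolding cis_pi_fraction_power[OF k, symmetric] by simp
    then have "z ^ k = (- 1) ^ p * cis (real k * t)"
      by (simp add: z_def power_mult_distrib t Complex.DeMoivre)
    moreover have "((- 1) ^ p :: complex) = of_real ((- 1) ^ p)" by simp
    moreover have "Re (of_real a * c) = a * Re c" for a c by simp
    ultimately show ?thesis
      by (simp only: \<open>x $ 1 = cos t\<close> poly_chebyshev_T_cos cis.sel)
  qed
  moreover have "norm z = 1"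
    by (simp add: z_def norm_mult nx)
  note poisson_series_sums[OF k this assms(8,9,2)]
  ultimately show ?thesis
    unfolding Y by (simp add: mult_ac)
qed

end
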